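(* Let $H$ be an infinite dimensional separable Hilbert space and $I$ a countable index set. Let $w=\{w_j\}_{j\in I}$ be a frame sequence in $H$ with canonical dual $\widetilde w=\{\widetilde w_j\}_{j\in I}$, $f=\{f_i\}_{i\in I}$ a frame for $H$ and $u=\{u_i\}_{i\in I}$ a Parseval frame for $H$. Let $y_i:=\sum_{k\in I}\langle u_k,f_i\rangle\widetilde w_k$, $i\in I$. Then there exists an orthonormal basis $v=\{v_i\}_{i\in I}$ of $H$ such that $w$ is a weak R-dual of $f$ with respect to the Parseval frame $u$ and the orthonormal basis $v$ if and only if all of the following hold: $\{y_i\}_{i\in I}$ is a Parseval frame for $\overline{span}\{w_j\}_{j\in I}$; $\dim(Ker(T_y))=\dim((span\{w_j\})^\perp)$; and $(G(\widetilde w,w)^t-\mathcal I)G(u,f)=\mathbf 0$, i.e. $\sum_{k\in I}\langle\widetilde w_k,w_j\rangle\langle u_k,f_i\rangle=\langle u_j,f_i\rangle$ for all $i,j\in I$.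
   Context: Inner products are linear in the first variable. A sequence $\{f_i\}_{i\in I}$ in $H$ is a frame for $H$ if there are $0<A\le B<\infty$ with $A\|x\|^2\le\sum_{i}|\langle x,f_i\rangle|^2\le B\|x\|^2$ for all $x\in H$; it is a Parseval frame if one can take $A=B=1$. A sequence is a frame sequence if it is a frame for its closed linear span. The canonical dual of a frame sequence $w$ is $\widetilde w_j=S_w^{-1}w_j$, where $S_w g=\sum_j\langle g,w_j\rangle w_j$ is the frame operator of $w$ on $\overline{span}\{w_j\}$. $T_y:\ell^2(I)\to H$, $T_y(\{c_i\})=\sum_i c_iy_i$, is the synthesis operator of $y=\{y_i\}_{i\in I}$. Dimensions are Hilbert space dimensions (finite or $\infty$; all spaces are separable). For sequences $g,h$ in $H$ indexed by $I$, $G(g,h)$ denotes the matrix $(\langle g_i,h_j\rangle)_{i,j\in I}$, $G(g,h)^t$ its transpose, and $\mathcal I$ the infinite identity matrix. Weak R-dual: let $u,v$ be Parseval frames for $H$ and $f$ a sequence in $H$ such that $\sum_{i\in I}|\langle f_i,u_j\rangle|^2<\infty$ for all $j\in I$ and $(G(v,v)^t-\mathcal I)G(f,u)=\mathbf 0$ (i.e. $\sum_{k}\langle v_k,v_i\rangle\langle f_k,u_j\rangle=\langle f_i,u_j\rangle$ for all $i,j$). Then the sequence $w=\{w_j\}_{j\in I}$ given by $w_j=\sum_{i\in I}\langle f_i,u_j\rangle v_i$ is called the weak R-dual of $f$ with respect to $u$ and $v$. (So "$w$ is a weak R-dual of $f$ with respect to $u$ and $v$" means that all these conditions hold.) *)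

theory Defs
  imports "HOL-Analysis.Analysis" "HOL-Library.Extended_Nat"
begin

section \<open>Complex Hilbert spaces\<close>

text \<open>
  The real structure (norm, topology, completeness) is inherited from \<^class>\<open>real_inner\<close> and
  \<^class>\<open>banach\<close>; the two compatibility axioms say that the real inner product is the real part of
  the complex one, so that the norm of \<open>x\<close> is the square root of \<open>cinner x x\<close>.  The complex inner
  product is linear in the first and conjugate linear in the second variable.
\<close>

class chilbert_space = real_inner + banach +
  fixes scaleC :: "complex \<Rightarrow> 'a \<Rightarrow> 'a" (infixr "*\<^sub>C" 75)
    and cinner :: "'a \<Rightarrow> 'a \<Rightarrow> complex"
  assumes scaleC_add_right: "a *\<^sub>C (x + y) = a *\<^sub>C x + a *\<^sub>C y"
    and scaleC_add_left: "(a + b) *\<^sub>C x = a *\<^sub>C x + b *\<^sub>C x"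
    and scaleC_scaleC: "a *\<^sub>C (b *\<^sub>C x) = (a * b) *\<^sub>C x"
    and scaleR_scaleC: "r *\<^sub>R x = complex_of_real r *\<^sub>C x"
    and cinner_commute: "cinner x y = cnj (cinner y x)"
    and cinner_add_left: "cinner (x + y) z = cinner x z + cinner y z"
    and cinner_scaleC_left: "cinner (a *\<^sub>C x) y = a * cinner x y"
    and inner_cinner: "inner x y = Re (cinner x y)"

global_interpretation complex_vector: vector_space "scaleC :: complex \<Rightarrow> 'a \<Rightarrow> 'a::chilbert_space"
proof
  show "1 *\<^sub>C x = x" for x :: 'a
    using scaleR_scaleC[of 1 x] by simp
qed (simp_all add: scaleC_add_right scaleC_add_left scaleC_scaleC)

definition cspan :: "'a::chilbert_space set \<Rightarrow> 'a set" where
  "cspan = module.span scaleC"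

definition closed_cspan :: "'a::chilbert_space set \<Rightarrow> 'a set" where
  "closed_cspan S = closure (cspan S)"

definition orthogonal_complement :: "'a::chilbert_space set \<Rightarrow> 'a set" where
  "orthogonal_complement S = {x. \<forall>y\<in>S. cinner x y = 0}"

definition is_onb_of :: "'a::chilbert_space set \<Rightarrow> 'a set \<Rightarrow> bool" where
  "is_onb_of B V \<longleftrightarrow> (\<forall>x\<in>B. \<forall>y\<in>B. cinner x y = (if x = y then 1 else 0)) \<and> closed_cspan B = V"

text \<open>
  Hilbert space dimension of a closed subspace: the common cardinality of its orthonormal bases,
  all infinite cardinalities being identified.
\<close>

definition hilbert_dim :: "'a::chilbert_space set \<Rightarrow> enat" where
  "hilbert_dim V =
    (THE n. \<exists>B. is_onb_of B V \<and> n = (if finite B then enat (card B) else \<infinity>))"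

definition orthonormal_basis :: "('i \<Rightarrow> 'a::chilbert_space) \<Rightarrow> bool" where
  "orthonormal_basis v \<longleftrightarrow>
    (\<forall>i j. cinner (v i) (v j) = (if i = j then 1 else 0)) \<and> closed_cspan (range v) = UNIV"


section \<open>The Hilbert space of square-summable families\<close>

typedef 'i ell2 = "{c :: 'i \<Rightarrow> complex. (\<lambda>i. (cmod (c i))\<^sup>2) summable_on UNIV}"
  morphisms ell2_coeff Abs_ell2
  by (rule exI[of _ "\<lambda>_. 0"]) simp

setup_lifting type_definition_ell2

lemma sq_summable_add:
  assumes "(\<lambda>i. (cmod (a i))\<^sup>2) summable_on UNIV" "(\<lambda>i. (cmod (b i))\<^sup>2) summable_on UNIV"
  shows "(\<lambda>i. (cmod (a i + b i))\<^sup>2) summable_on UNIV"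
proof (rule summable_on_comparison_test)
  show "(\<lambda>i. 2 * (cmod (a i))\<^sup>2 + 2 * (cmod (b i))\<^sup>2) summable_on UNIV"
    by (intro summable_on_add summable_on_cmult_right assms)
  show "(cmod (a i + b i))\<^sup>2 \<le> 2 * (cmod (a i))\<^sup>2 + 2 * (cmod (b i))\<^sup>2" for i
  proof -
    have "(cmod (a i + b i))\<^sup>2 \<le> (cmod (a i) + cmod (b i))\<^sup>2"
      by (intro power_mono norm_triangle_ineq) auto
    also have "\<dots> \<le> 2 * (cmod (a i))\<^sup>2 + 2 * (cmod (b i))\<^sup>2"
      using sum_squares_bound[of "cmod (a i)" "cmod (b i)"] by (simp add: power2_sum)
    finally show ?thesis .
  qed
qed simp

lemma sq_summable_scale:
  assumes "(\<lambda>i. (cmod (a i))\<^sup>2) summable_on UNIV"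
  shows "(\<lambda>i. (cmod (r * a i))\<^sup>2) summable_on UNIV"
  using summable_on_cmult_right[OF assms, of "(cmod r)\<^sup>2"]
  by (simp add: norm_mult power_mult_distrib)

lemma sq_summable_mult:
  assumes "(\<lambda>i. (cmod (a i))\<^sup>2) summable_on UNIV" "(\<lambda>i. (cmod (b i))\<^sup>2) summable_on UNIV"
  shows "(\<lambda>i. a i * cnj (b i)) summable_on UNIV"
proof (rule abs_summable_summable, rule summable_on_comparison_test)
  show "(\<lambda>i. (cmod (a i))\<^sup>2 + (cmod (b i))\<^sup>2) summable_on UNIV"
    by (intro summable_on_add assms)
  show "cmod (a i * cnj (b i)) \<le> (cmod (a i))\<^sup>2 + (cmod (b i))\<^sup>2" for i
  proof -
    have "2 * (cmod (a i) * cmod (b i)) \<le> (cmod (a i))\<^sup>2 + (cmod (b i))\<^sup>2"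
      using sum_squares_bound[of "cmod (a i)" "cmod (b i)"] by simp
    moreover have "0 \<le> cmod (a i) * cmod (b i)" by simp
    ultimately have "cmod (a i) * cmod (b i) \<le> (cmod (a i))\<^sup>2 + (cmod (b i))\<^sup>2" by linarith
    then show ?thesis by (simp add: norm_mult)
  qed
qed simp

instantiation ell2 :: (type) real_inner
begin

lift_definition zero_ell2 :: "'a ell2" is "\<lambda>_. 0" by simp
lift_definition plus_ell2 :: "'a ell2 \<Rightarrow> 'a ell2 \<Rightarrow> 'a ell2" is "\<lambda>c d i. c i + d i"
  by (rule sq_summable_add)
lift_definition uminus_ell2 :: "'a ell2 \<Rightarrow> 'a ell2" is "\<lambda>c i. - c i" by simp
lift_definition minus_ell2 :: "'a ell2 \<Rightarrow> 'a ell2 \<Rightarrow> 'a ell2" is "\<lambda>c d i. c i - d i"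
  using sq_summable_add[of _ "\<lambda>i. - _ i"] by simp
lift_definition scaleR_ell2 :: "real \<Rightarrow> 'a ell2 \<Rightarrow> 'a ell2" is "\<lambda>r c i. complex_of_real r * c i"
  by (rule sq_summable_scale)
lift_definition inner_ell2 :: "'a ell2 \<Rightarrow> 'a ell2 \<Rightarrow> real" is
  "\<lambda>c d. Re (\<Sum>\<^sub>\<infinity>i. c i * cnj (d i))" .

definition norm_ell2 :: "'a ell2 \<Rightarrow> real" where
  "norm_ell2 c = sqrt (inner c c)"
definition sgn_ell2 :: "'a ell2 \<Rightarrow> 'a ell2" where
  "sgn_ell2 c = inverse (norm c) *\<^sub>R c"
definition dist_ell2 :: "'a ell2 \<Rightarrow> 'a ell2 \<Rightarrow> real" where
  "dist_ell2 c d = norm (c - d)"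
definition uniformity_ell2 :: "('a ell2 \<times> 'a ell2) filter" where
  "uniformity_ell2 = (INF e\<in>{0<..}. principal {(x, y). dist x y < e})"
definition open_ell2 :: "'a ell2 set \<Rightarrow> bool" where
  "open_ell2 U = (\<forall>x\<in>U. eventually (\<lambda>(x', y). x' = x \<longrightarrow> y \<in> U) uniformity)"

lemma ell2_summable: "(\<lambda>i. (cmod (ell2_coeff c i))\<^sup>2) summable_on UNIV"
  using ell2_coeff[of c] by simp

lemma ell2_inner_self: "inner c c = (\<Sum>\<^sub>\<infinity>i. (cmod (ell2_coeff c i))\<^sup>2)"
proof -
  have "(\<Sum>\<^sub>\<infinity>i. ell2_coeff c i * cnj (ell2_coeff c i)) =
      (\<Sum>\<^sub>\<infinity>i. complex_of_real ((cmod (ell2_coeff c i))\<^sup>2))"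
    by (simp only: complex_norm_square)
  also have "\<dots> = complex_of_real (\<Sum>\<^sub>\<infinity>i. (cmod (ell2_coeff c i))\<^sup>2)"
    by (intro infsumI has_sum_of_real has_sum_infsum ell2_summable)
  finally show ?thesis
    by (simp add: inner_ell2.rep_eq)
qed

lemma ell2_cinner_commute:
  "(\<Sum>\<^sub>\<infinity>i. ell2_coeff c i * cnj (ell2_coeff d i)) =
   cnj (\<Sum>\<^sub>\<infinity>i. ell2_coeff d i * cnj (ell2_coeff c i))"
  by (simp add: mult.commute flip: infsum_cnj)

lemma ell2_cinner_add_left:
  "(\<Sum>\<^sub>\<infinity>i. ell2_coeff (b + c) i * cnj (ell2_coeff d i)) =
   (\<Sum>\<^sub>\<infinity>i. ell2_coeff b i * cnj (ell2_coeff d i)) + (\<Sum>\<^sub>\<infinity>i. ell2_coeff c i * cnj (ell2_coeff d i))"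
  by (simp add: plus_ell2.rep_eq distrib_right infsum_add sq_summable_mult ell2_summable)

instance
proof
  fix x y z :: "'a ell2" and r s :: real
  show "x + y + z = x + (y + z)" by transfer (simp add: add.assoc)
  show "x + y = y + x" by transfer (simp add: add.commute)
  show "0 + x = x" by transfer simp
  show "- x + x = 0" by transfer simp
  show "x - y = x + - y" by transfer simp
  show "r *\<^sub>R (x + y) = r *\<^sub>R x + r *\<^sub>R y" by transfer (simp add: algebra_simps)
  show "(r + s) *\<^sub>R x = r *\<^sub>R x + s *\<^sub>R x" by transfer (simp add: algebra_simps)
  show "r *\<^sub>R s *\<^sub>R x = (r * s) *\<^sub>R x" by transfer (simp add: algebra_simps)
  show "1 *\<^sub>R x = x" by transfer simp
  show "sgn x = inverse (norm x) *\<^sub>R x" by (rule sgn_ell2_def)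
  show "dist x y = norm (x - y)" by (rule dist_ell2_def)
  show "(uniformity :: ('a ell2 \<times> 'a ell2) filter) = (INF e\<in>{0<..}. principal {(x, y). dist x y < e})"
    by (rule uniformity_ell2_def)
  show "open U = (\<forall>x\<in>U. eventually (\<lambda>(x', y). x' = x \<longrightarrow> y \<in> U) uniformity)" for U :: "'a ell2 set"
    by (rule open_ell2_def)
  show "inner x y = inner y x"
    using ell2_cinner_commute[of x y] by (simp add: inner_ell2.rep_eq)
  show "inner (x + y) z = inner x z + inner y z"
    by (simp add: inner_ell2.rep_eq ell2_cinner_add_left)
  show "inner (r *\<^sub>R x) y = r * inner x y"
    by (simp add: inner_ell2.rep_eq scaleR_ell2.rep_eq mult.assoc infsum_cmult_right')
  show "0 \<le> inner x x"
    by (simp add: ell2_inner_self infsum_nonneg)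
  show "inner x x = 0 \<longleftrightarrow> x = 0"
  proof
    assume "inner x x = 0"
    then have "(cmod (ell2_coeff x i))\<^sup>2 = 0" for i
      using nonneg_infsum_le_0D[of "\<lambda>i. (cmod (ell2_coeff x i))\<^sup>2" UNIV i]
      by (simp add: ell2_summable ell2_inner_self)
    then show "x = 0"
      by (auto simp: zero_ell2.rep_eq fun_eq_iff simp flip: ell2_coeff_inject)
  qed (simp add: ell2_inner_self zero_ell2.rep_eq)
  show "norm x = sqrt (inner x x)" by (rule norm_ell2_def)
qed

end

lemma ell2_norm_sq: "(norm c)\<^sup>2 = (\<Sum>\<^sub>\<infinity>i. (cmod (ell2_coeff c i))\<^sup>2)"
  by (simp add: norm_ell2_def ell2_inner_self infsum_nonneg)

lemma ell2_sum_le_norm: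
  "finite F \<Longrightarrow> (\<Sum>i\<in>F. (cmod (ell2_coeff c i))\<^sup>2) \<le> (norm c)\<^sup>2"
  unfolding ell2_norm_sq by (intro finite_sum_le_infsum) (auto simp: ell2_summable)

instance ell2 :: (type) banach
proof
  fix X :: "nat \<Rightarrow> 'a ell2"
  assume X: "Cauchy X"
  have le: "cmod (ell2_coeff c i) \<le> norm c" for c :: "'a ell2" and i
    using ell2_sum_le_norm[of "{i}" c] by (simp add: power2_le_iff_abs_le)
  have "Cauchy (\<lambda>n. ell2_coeff (X n) i)" for i
  proof (rule metric_CauchyI)
    fix e :: real assume "e > 0"
    then obtain M where M: "\<And>m n. m \<ge> M \<Longrightarrow> n \<ge> M \<Longrightarrow> norm (X m - X n) < e"
      using CauchyD[OF X] by blast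
    have "dist (ell2_coeff (X m) i) (ell2_coeff (X n) i) < e" if "m \<ge> M" "n \<ge> M" for m n
      using le[of "X m - X n" i] M[OF that] by (simp add: minus_ell2.rep_eq dist_norm)
    then show "\<exists>M. \<forall>m\<ge>M. \<forall>n\<ge>M. dist (ell2_coeff (X m) i) (ell2_coeff (X n) i) < e" by blast
  qed
  then obtain l where l: "\<And>i. (\<lambda>n. ell2_coeff (X n) i) \<longlonglongrightarrow> l i"
    unfolding Cauchy_convergent_iff convergent_def by metis
  have bound: "(\<Sum>i\<in>F. (cmod (ell2_coeff (X n) i - l i))\<^sup>2) \<le> e\<^sup>2"
    if "finite F" and M: "\<And>m. m \<ge> M \<Longrightarrow> norm (X n - X m) < e" for F n M e
  proof (rule tendsto_upperbound)
    show "(\<lambda>m. \<Sum>i\<in>F. (cmod (ell2_coeff (X n) i - ell2_coeff (X m) i))\<^sup>2)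
        \<longlonglongrightarrow> (\<Sum>i\<in>F. (cmod (ell2_coeff (X n) i - l i))\<^sup>2)"
      by (intro tendsto_intros l)
    have "(\<Sum>i\<in>F. (cmod (ell2_coeff (X n) i - ell2_coeff (X m) i))\<^sup>2) \<le> e\<^sup>2" if "m \<ge> M" for m
    proof -
      have "(norm (X n - X m))\<^sup>2 \<le> e\<^sup>2"
        using M[OF that] by (intro power_mono) auto
      then show ?thesis
        using ell2_sum_le_norm[OF \<open>finite F\<close>, of "X n - X m"] by (simp add: minus_ell2.rep_eq)
    qed
    then show "\<forall>\<^sub>F m in sequentially.
        (\<Sum>i\<in>F. (cmod (ell2_coeff (X n) i - ell2_coeff (X m) i))\<^sup>2) \<le> e\<^sup>2"
      unfolding eventually_sequentially by blast
  qed simp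
  have summable: "(\<lambda>i. (cmod (ell2_coeff (X n) i - l i))\<^sup>2) summable_on UNIV"
    if "\<And>m. m \<ge> M \<Longrightarrow> norm (X n - X m) < e" for n M e
    by (rule nonneg_bdd_above_summable_on) (auto intro!: bdd_aboveI2 bound[OF _ that])
  obtain N where "\<And>m. m \<ge> N \<Longrightarrow> norm (X N - X m) < 1"
    using CauchyD[OF X, of 1] by auto
  from summable[OF this]
  have "(\<lambda>i. (cmod (ell2_coeff (X N) i + (- 1) * (ell2_coeff (X N) i - l i)))\<^sup>2) summable_on UNIV"
    by (intro sq_summable_add sq_summable_scale ell2_summable)
  then have "(\<lambda>i. (cmod (l i))\<^sup>2) summable_on UNIV" by simp
  then obtain L where L: "ell2_coeff L = l"
    using Abs_ell2_inverse[of l] by auto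
  have "X \<longlonglongrightarrow> L"
  proof (rule LIMSEQ_I)
    fix r :: real assume "r > 0"
    then obtain M where M: "\<And>m n. m \<ge> M \<Longrightarrow> n \<ge> M \<Longrightarrow> norm (X m - X n) < r / 2"
      using CauchyD[OF X, of "r / 2"] by auto
    have "norm (X n - L) < r" if "n \<ge> M" for n
    proof -
      have "(norm (X n - L))\<^sup>2 \<le> (r / 2)\<^sup>2"
        unfolding ell2_norm_sq
        by (rule infsum_le_finite_sums)
          (auto simp: minus_ell2.rep_eq L intro!: summable[OF M[OF that]] bound[OF _ M[OF that]])
      then have "norm (X n - L) \<le> r / 2"
        using \<open>r > 0\<close> by (simp add: power2_le_iff_abs_le)
      then show ?thesis using \<open>r > 0\<close> by simp
    qed
    then show "\<exists>M. \<forall>n\<ge>M. norm (X n - L) < r" by blast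
  qed
  then show "convergent X" by (rule convergentI)
qed

instantiation ell2 :: (type) chilbert_space
begin

lift_definition scaleC_ell2 :: "complex \<Rightarrow> 'a ell2 \<Rightarrow> 'a ell2" is "\<lambda>a c i. a * c i"
  by (rule sq_summable_scale)
lift_definition cinner_ell2 :: "'a ell2 \<Rightarrow> 'a ell2 \<Rightarrow> complex" is
  "\<lambda>c d. \<Sum>\<^sub>\<infinity>i. c i * cnj (d i)" .

instance
proof
  fix x y z :: "'a ell2" and a b :: complex and r :: real
  show "a *\<^sub>C (x + y) = a *\<^sub>C x + a *\<^sub>C y" by transfer (simp add: algebra_simps)
  show "(a + b) *\<^sub>C x = a *\<^sub>C x + b *\<^sub>C x" by transfer (simp add: algebra_simps)
  show "a *\<^sub>C (b *\<^sub>C x) = (a * b) *\<^sub>C x" by transfer (simp add: algebra_simps)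
  show "r *\<^sub>R x = complex_of_real r *\<^sub>C x" by transfer simp
  show "cinner x y = cnj (cinner y x)"
    unfolding cinner_ell2.rep_eq by (rule ell2_cinner_commute)
  show "cinner (x + y) z = cinner x z + cinner y z"
    unfolding cinner_ell2.rep_eq by (rule ell2_cinner_add_left)
  show "cinner (a *\<^sub>C x) y = a * cinner x y"
    by (simp add: cinner_ell2.rep_eq scaleC_ell2.rep_eq mult.assoc infsum_cmult_right')
  show "inner x y = Re (cinner x y)"
    by (simp add: inner_ell2.rep_eq cinner_ell2.rep_eq)
qed

end


section \<open>Frames\<close>

text \<open>
  Families are indexed by a whole type.  All series are unconditional (\<^const>\<open>infsum\<close>), which is
  the appropriate notion for an unordered index set; since \<^const>\<open>infsum\<close> is \<open>0\<close> for divergent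
  series, summability is part of the frame condition.
\<close>

definition frame_bounds :: "('i \<Rightarrow> 'a::chilbert_space) \<Rightarrow> 'a set \<Rightarrow> real \<Rightarrow> real \<Rightarrow> bool" where
  "frame_bounds f V A B \<longleftrightarrow> (\<forall>x\<in>V.
    (\<lambda>i. (cmod (cinner x (f i)))\<^sup>2) summable_on UNIV \<and>
    A * (norm x)\<^sup>2 \<le> (\<Sum>\<^sub>\<infinity>i. (cmod (cinner x (f i)))\<^sup>2) \<and>
    (\<Sum>\<^sub>\<infinity>i. (cmod (cinner x (f i)))\<^sup>2) \<le> B * (norm x)\<^sup>2)"

definition is_frame :: "('i \<Rightarrow> 'a::chilbert_space) \<Rightarrow> 'a set \<Rightarrow> bool" where
  "is_frame f V \<longleftrightarrow> range f \<subseteq> V \<and> (\<exists>A B. 0 < A \<and> A \<le> B \<and> frame_bounds f V A B)"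

definition is_parseval_frame :: "('i \<Rightarrow> 'a::chilbert_space) \<Rightarrow> 'a set \<Rightarrow> bool" where
  "is_parseval_frame f V \<longleftrightarrow> range f \<subseteq> V \<and> frame_bounds f V 1 1"

definition is_frame_sequence :: "('i \<Rightarrow> 'a::chilbert_space) \<Rightarrow> bool" where
  "is_frame_sequence w \<longleftrightarrow> is_frame w (closed_cspan (range w))"

definition frame_operator :: "('i \<Rightarrow> 'a::chilbert_space) \<Rightarrow> 'a \<Rightarrow> 'a" where
  "frame_operator w g = (\<Sum>\<^sub>\<infinity>j. cinner g (w j) *\<^sub>C w j)"

text \<open>
  The inverse is that of the restriction of the frame operator to the closed linear span, on which
  it is bijective if \<open>w\<close> is a frame sequence.
\<close>

definition canonical_dual :: "('i \<Rightarrow> 'a::chilbert_space) \<Rightarrow> 'i \<Rightarrow> 'a" where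
  "canonical_dual w j = inv_into (closed_cspan (range w)) (frame_operator w) (w j)"

definition synthesis :: "('i \<Rightarrow> 'a::chilbert_space) \<Rightarrow> 'i ell2 \<Rightarrow> 'a" where
  "synthesis y c = (\<Sum>\<^sub>\<infinity>i. ell2_coeff c i *\<^sub>C y i)"


section \<open>Infinite matrices and weak R-duals\<close>

definition gram_matrix ::
    "('i \<Rightarrow> 'a::chilbert_space) \<Rightarrow> ('i \<Rightarrow> 'a) \<Rightarrow> 'i \<Rightarrow> 'i \<Rightarrow> complex" where
  "gram_matrix g h = (\<lambda>i j. cinner (g i) (h j))"

definition imat_transpose :: "('i \<Rightarrow> 'i \<Rightarrow> complex) \<Rightarrow> 'i \<Rightarrow> 'i \<Rightarrow> complex" where
  "imat_transpose A = (\<lambda>i j. A j i)"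

definition imat_id :: "'i \<Rightarrow> 'i \<Rightarrow> complex" where
  "imat_id = (\<lambda>i j. if i = j then 1 else 0)"

text \<open>
  In the matrix products below the rows of the first and the columns of the second factor are
  square-summable (by the frame and summability hypotheses), so all entries converge absolutely.
\<close>

definition imat_mult ::
    "('i \<Rightarrow> 'i \<Rightarrow> complex) \<Rightarrow> ('i \<Rightarrow> 'i \<Rightarrow> complex) \<Rightarrow> 'i \<Rightarrow> 'i \<Rightarrow> complex" where
  "imat_mult A B = (\<lambda>i j. \<Sum>\<^sub>\<infinity>k. A i k * B k j)"

definition is_weak_R_dual ::
    "('i \<Rightarrow> 'a::chilbert_space) \<Rightarrow> ('i \<Rightarrow> 'a) \<Rightarrow> ('i \<Rightarrow> 'a) \<Rightarrow> ('i \<Rightarrow> 'a) \<Rightarrow> bool" where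
  "is_weak_R_dual w f u v \<longleftrightarrow>
    is_parseval_frame u UNIV \<and> is_parseval_frame v UNIV \<and>
    (\<forall>j. (\<lambda>i. (cmod (cinner (f i) (u j)))\<^sup>2) summable_on UNIV) \<and>
    imat_mult (imat_transpose (gram_matrix v v) - imat_id) (gram_matrix f u) = (\<lambda>_ _. 0) \<and>
    (\<forall>j. w j = (\<Sum>\<^sub>\<infinity>i. cinner (f i) (u j) *\<^sub>C v i))"

end

theory Submission
  imports Defs
begin

text \<open>
  If \<open>w\<close> is a weak R-dual with respect to an orthonormal basis \<open>v\<close>, then \<open>cinner (u k) (f i)\<close> equals
  \<open>cinner (v i) (w k)\<close>, so \<open>y i\<close> is the orthogonal projection of \<open>v i\<close> to the closed span \<open>W\<close> of \<open>w\<close>.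
  Projected orthonormal bases of this kind are Parseval frames of \<open>W\<close>, and the unitary synthesis operator
  of \<open>v\<close> maps the kernel of the synthesis operator of \<open>y\<close> onto the complement of \<open>W\<close>.  Conversely, a
  Parseval frame \<open>y\<close> of \<open>W\<close> whose kernel has the dimension of that complement is the projection of an
  orthonormal basis (Naimark dilation inside the given space).
\<close>

section \<open>Complex inner products\<close>

text \<open>The Parseval and dimension conditions supply the basis; the matrix condition ties it to
  \<open>w\<close>. Its entries say \<open>cinner (y i) (w j) = cinner (u j) (f i)\<close>, and
  since \<open>w j\<close> lies in \<open>W\<close>, every \<open>v i\<close> that projects to
  \<open>y i\<close> has the same pairing with \<open>w j\<close>. This is the coefficient equation
  of a weak R-dual. One obstacle is that \<open>hilbert_dim\<close> identifies all infinite
  cardinalities: equal dimensions give a unitary map only once the orthonormal sets involved are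
  known to be countable. The countable total families \<open>u\<close> in the given space and
  \<open>ell2_unit\<close> in the sequence space ensure this. Projections are not built as
  operators. They are expressed by inner products against vectors of \<open>W\<close>, and Bessel
  bounds guarantee convergence of the series, whose value would otherwise default to 0.\<close>

lemma cinner_add_right: "cinner x (y + z) = cinner x y + cinner x (z :: 'a::chilbert_space)"
  by (metis cinner_add_left cinner_commute complex_cnj_add)

lemma cinner_scaleC_right: "cinner x (a *\<^sub>C y) = cnj a * cinner x (y :: 'a::chilbert_space)"
  by (metis cinner_commute cinner_scaleC_left complex_cnj_mult)

lemma cinner_self: "cinner x x = complex_of_real ((norm x)\<^sup>2)" for x :: "'a::chilbert_space"
  using cinner_commute[of x x]
  by (auto simp: complex_eq_iff power2_norm_eq_inner inner_cinner)

text \<open>The inherited norm is homogeneous for real scalars only; complex homogeneity has to come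
  from the complex inner product.\<close>

lemma norm_scaleC: "norm (a *\<^sub>C x) = cmod a * norm x" for x :: "'a::chilbert_space"
proof -
  have "complex_of_real ((norm (a *\<^sub>C x))\<^sup>2) = a * cnj a * cinner x x"
    unfolding cinner_self[symmetric] by (simp add: cinner_scaleC_left cinner_scaleC_right)
  also have "\<dots> = complex_of_real ((cmod a * norm x)\<^sup>2)"
    by (simp add: cinner_self power_mult_distrib flip: complex_norm_square)
  finally have "complex_of_real ((norm (a *\<^sub>C x))\<^sup>2) = complex_of_real ((cmod a * norm x)\<^sup>2)" .
  then show ?thesis
    by (simp only: of_real_eq_iff power2_eq_iff_nonneg norm_ge_zero mult_nonneg_nonneg)
qed

text \<open>Rotating \<open>x\<close> by the conjugate phase of \<open>cinner x y\<close> makes the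
  inner product real and nonnegative, so the real inequality applies.\<close>

lemma Cauchy_Schwarz_cinner: "cmod (cinner x y) \<le> norm x * norm y"
  for x y :: "'a::chilbert_space"
proof -
  define a where "a = cnj (sgn (cinner x y))"
  have "cinner (a *\<^sub>C x) y = complex_of_real (cmod (cinner x y))"
    by (simp add: a_def cinner_scaleC_left mult.commute[of "cnj _"] sgn_eq complex_norm_square
        [symmetric] power2_eq_square)
  then have "cmod (cinner x y) = inner (a *\<^sub>C x) y"
    by (simp add: inner_cinner)
  also have "\<dots> \<le> norm (a *\<^sub>C x) * norm y"
    by (rule norm_cauchy_schwarz)
  also have "\<dots> \<le> norm x * norm y"
    by (auto simp: norm_scaleC a_def norm_sgn)
  finally show ?thesis .
qed

lemma bounded_linear_cinner_left: "bounded_linear (\<lambda>x. cinner x (z :: 'a::chilbert_space))"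
  by (rule bounded_linear_intro[where K = "norm z"])
    (simp_all add: cinner_add_left scaleR_scaleC cinner_scaleC_left Cauchy_Schwarz_cinner
      scaleR_conv_of_real)

lemma bounded_linear_cinner_right: "bounded_linear (\<lambda>x. cinner (z :: 'a::chilbert_space) x)"
  by (rule bounded_linear_intro[where K = "norm z"])
    (use Cauchy_Schwarz_cinner[of z] in \<open>simp_all add: cinner_add_right scaleR_scaleC
      cinner_scaleC_right scaleR_conv_of_real mult.commute\<close>)

lemmas cinner_zero_left [simp] = linear_0[OF bounded_linear.linear[OF bounded_linear_cinner_left]]
lemmas cinner_zero_right [simp] = linear_0[OF bounded_linear.linear[OF bounded_linear_cinner_right]]
lemmas cinner_diff_left = linear_diff[OF bounded_linear.linear[OF bounded_linear_cinner_left]]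
lemmas cinner_diff_right = linear_diff[OF bounded_linear.linear[OF bounded_linear_cinner_right]]
lemmas cinner_sum_left = linear_sum[OF bounded_linear.linear[OF bounded_linear_cinner_left]]
lemmas cinner_sum_right = linear_sum[OF bounded_linear.linear[OF bounded_linear_cinner_right]]

lemma cinner_self_eq_0 [simp]: "cinner x x = 0 \<longleftrightarrow> x = 0" for x :: "'a::chilbert_space"
  by (simp add: cinner_self)

lemma cinner_eq_0_commute: "cinner x y = 0 \<longleftrightarrow> cinner y x = 0" for x y :: "'a::chilbert_space"
  by (metis cinner_commute complex_cnj_zero)

lemma cmod_cinner_commute: "cmod (cinner x y) = cmod (cinner y x)" for x y :: "'a::chilbert_space"
  by (metis cinner_commute complex_mod_cnj)

lemma cinner_ext:
  fixes x y :: "'a::chilbert_space"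
  assumes "\<And>z. cinner x z = cinner y z"
  shows "x = y"
  using assms[of "x - y"] cinner_self_eq_0[of "x - y"] by (simp add: cinner_diff_left)

lemma continuous_cinner_left: "continuous_on S (\<lambda>x. cinner x (z :: 'a::chilbert_space))"
  by (rule linear_continuous_on[OF bounded_linear_cinner_left])

section \<open>Closed subspaces\<close>

lemma subspace_orthogonal_complement: "complex_vector.subspace (orthogonal_complement S)"
  by (auto simp: complex_vector.subspace_def orthogonal_complement_def cinner_add_left
      cinner_scaleC_left)

lemma closed_orthogonal_complement: "closed (orthogonal_complement S)"
proof -
  have "orthogonal_complement S = (\<Inter>y\<in>S. {x. cinner x y = 0})"
    by (auto simp: orthogonal_complement_def)
  then show ?thesis
    by (auto intro!: closed_INT closed_Collect_eq continuous_cinner_left continuous_on_const)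
qed

lemma bounded_linear_scaleC_right: "bounded_linear (\<lambda>x. a *\<^sub>C (x :: 'a::chilbert_space))"
  by (rule bounded_linear_intro[where K = "cmod a"])
    (simp_all add: scaleC_add_right scaleR_scaleC scaleC_scaleC mult.commute norm_scaleC)

lemma subspace_closure:
  assumes "complex_vector.subspace V"
  shows "complex_vector.subspace (closure V)"
proof (rule complex_vector.subspaceI)
  show "0 \<in> closure V"
    using complex_vector.subspace_0[OF assms] closure_subset by blast
  show "x + y \<in> closure V" if "x \<in> closure V" "y \<in> closure V" for x y
  proof -
    from that obtain a b where "\<And>n. a n \<in> V" "a \<longlonglongrightarrow> x" "\<And>n. b n \<in> V" "b \<longlonglongrightarrow> y"
      by (auto simp: closure_sequential)
    then show ?thesis
      unfolding closure_sequential
      by (intro exI[of _ "\<lambda>n. a n + b n"])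
        (auto intro: tendsto_add complex_vector.subspace_add[OF assms])
  qed
  show "c *\<^sub>C x \<in> closure V" if "x \<in> closure V" for c x
  proof -
    from that obtain a where "\<And>n. a n \<in> V" "a \<longlonglongrightarrow> x"
      by (auto simp: closure_sequential)
    then show ?thesis
      unfolding closure_sequential
      by (intro exI[of _ "\<lambda>n. c *\<^sub>C a n"])
        (auto intro: bounded_linear.tendsto[OF bounded_linear_scaleC_right]
          complex_vector.subspace_scale[OF assms])
  qed
qed

lemma subspace_closed_cspan: "complex_vector.subspace (closed_cspan S)"
  unfolding closed_cspan_def cspan_def
  by (intro subspace_closure complex_vector.subspace_span)

lemma closed_closed_cspan: "closed (closed_cspan S)"
  by (simp add: closed_cspan_def)

lemma subset_closed_cspan: "S \<subseteq> closed_cspan S"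
  unfolding closed_cspan_def cspan_def
  using complex_vector.span_superset closure_subset by blast

lemma closed_cspan_minimal:
  assumes "S \<subseteq> V" "complex_vector.subspace V" "closed V"
  shows "closed_cspan S \<subseteq> V"
  unfolding closed_cspan_def cspan_def
  by (intro closure_minimal complex_vector.span_minimal assms)

lemma orthogonal_complement_closed_cspan:
  "orthogonal_complement (closed_cspan S) = orthogonal_complement S"
proof
  show "orthogonal_complement S \<subseteq> orthogonal_complement (closed_cspan S)"
  proof
    fix x assume "x \<in> orthogonal_complement S"
    then have "closed_cspan S \<subseteq> orthogonal_complement {x}"
      by (intro closed_cspan_minimal subspace_orthogonal_complement closed_orthogonal_complement)
        (auto simp: orthogonal_complement_def cinner_eq_0_commute)
    then show "x \<in> orthogonal_complement (closed_cspan S)"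
      by (auto simp: orthogonal_complement_def subset_iff cinner_eq_0_commute[of x])
  qed
qed (use subset_closed_cspan[of S] in \<open>auto simp: orthogonal_complement_def\<close>)

lemma orthogonal_complement_cspan: "orthogonal_complement (cspan S) = orthogonal_complement S"
proof -
  have "S \<subseteq> cspan S" "cspan S \<subseteq> closed_cspan S"
    unfolding closed_cspan_def cspan_def
    by (rule complex_vector.span_superset, rule closure_subset)
  then have "orthogonal_complement (closed_cspan S) \<subseteq> orthogonal_complement (cspan S)"
    "orthogonal_complement (cspan S) \<subseteq> orthogonal_complement S"
    by (auto simp: orthogonal_complement_def)
  then show ?thesis
    by (simp add: orthogonal_complement_closed_cspan)
qed

text \<open>A divergent \<open>infsum\<close> is 0, which lies in every subspace, so membership can
  be had before convergence is discussed.\<close>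

lemma infsum_mem_subspace:
  assumes V: "complex_vector.subspace V" "closed V" and g: "\<And>i. i \<in> A \<Longrightarrow> g i \<in> V"
  shows "infsum g A \<in> V"
proof (cases "g summable_on A")
  case True
  show ?thesis
  proof (rule Lim_in_closed_set[OF V(2)])
    show "\<forall>\<^sub>F F in finite_subsets_at_top A. sum g F \<in> V"
      by (intro eventually_finite_subsets_at_top_weakI complex_vector.subspace_sum[OF V(1)])
        (use g in auto)
    show "(sum g \<longlongrightarrow> infsum g A) (finite_subsets_at_top A)"
      by (rule infsum_tendsto[OF True])
  qed simp
next
  case False
  then show ?thesis
    using complex_vector.subspace_0[OF V(1)] by (simp add: infsum_not_exists)
qed

section \<open>Bessel families\<close>

text \<open>Duality between synthesis and analysis bounds always yields a quadratic estimate; this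
  cancels the common factor, allowing for zero.\<close>

lemma le_of_mult_self_le:
  fixes a b :: real
  assumes "a * a \<le> b * a" "0 \<le> a" "0 \<le> b"
  shows "a \<le> b"
  using assms by (cases "a = 0") auto

text \<open>Bounding finite synthesis sums instead of coefficient sums gives the Cauchy criterion
  directly and mentions no test vectors. A frame bound known only on a subspace thereby extends to
  coefficients of arbitrary vectors.\<close>

definition bessel_on :: "('b \<Rightarrow> 'a::chilbert_space) \<Rightarrow> 'b set \<Rightarrow> real \<Rightarrow> bool" where
  "bessel_on g A C \<longleftrightarrow> 0 \<le> C \<and> (\<forall>c F. finite F \<longrightarrow> F \<subseteq> A \<longrightarrow>
    (norm (\<Sum>i\<in>F. c i *\<^sub>C g i))\<^sup>2 \<le> C * (\<Sum>i\<in>F. (cmod (c i))\<^sup>2))"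

lemma summable_on_norm_sq_dominated:
  fixes f :: "'b \<Rightarrow> 'a::banach" and g :: "'b \<Rightarrow> real"
  assumes g: "g summable_on A" and C: "0 \<le> C"
    and le: "\<And>F. finite F \<Longrightarrow> F \<subseteq> A \<Longrightarrow> (norm (sum f F))\<^sup>2 \<le> C * sum g F"
  shows "f summable_on A"
proof -
  have "\<exists>P. eventually P (finite_subsets_at_top A) \<and>
      (\<forall>F1 F2. P F1 \<and> P F2 \<longrightarrow> dist (sum f F1) (sum f F2) < e)" if "e > 0" for e
  proof -
    \<comment> \<open>Outside \<open>K\<close> a block has \<open>g\<close>-sum below
      \<open>2 * d\<close>, as both partial sums are within \<open>d\<close> of the limit. The
      constants are chosen so that \<open>(C + 1) * (2 * d) = (e / 2)\<^sup>2\<close>; taking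
      \<open>C + 1\<close> avoids division by zero.\<close>
    define q where "q = (e / 2)\<^sup>2 / 2"
    define d where "d = q / (C + 1)"
    have "d > 0" using \<open>e > 0\<close> C by (simp add: d_def q_def)
    have d: "(C + 1) * d = q" using C by (simp add: d_def)
    have "\<forall>\<^sub>F F in finite_subsets_at_top A. dist (sum g F) (infsum g A) < d"
      using infsum_tendsto[OF g] \<open>d > 0\<close> by (simp add: tendsto_iff)
    then obtain K where K: "finite K" "K \<subseteq> A"
      and Kd: "\<And>F. finite F \<Longrightarrow> K \<subseteq> F \<Longrightarrow> F \<subseteq> A \<Longrightarrow> dist (sum g F) (infsum g A) < d"
      by (auto simp: eventually_finite_subsets_at_top)
    have near: "dist (sum f F) (sum f K) < e / 2" if F: "finite F" "K \<subseteq> F" "F \<subseteq> A" for F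
    proof -
      have "sum g (F - K) < 2 * d"
        using Kd[OF F] Kd[OF K(1) order.refl K(2)] F K(1)
        by (subst sum_diff) (auto simp: dist_real_def)
      then have "C * sum g (F - K) \<le> C * (2 * d)"
        using C by (intro mult_left_mono) auto
      also have "\<dots> < (C + 1) * (2 * d)"
        using \<open>d > 0\<close> by simp
      also have "\<dots> = (e / 2)\<^sup>2"
        using d unfolding q_def by (simp add: algebra_simps)
      finally have "(norm (sum f (F - K)))\<^sup>2 < (e / 2)\<^sup>2"
        using le[of "F - K"] F by fastforce
      then have "norm (sum f (F - K)) < e / 2"
        using \<open>e > 0\<close> power_less_imp_less_base[of _ 2 "e / 2"] by fastforce
      then show ?thesis
        using F K(1) by (simp add: dist_norm sum_diff)
    qed
    have "dist (sum f F1) (sum f F2) < e"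
      if "finite F1" "K \<subseteq> F1" "F1 \<subseteq> A" "finite F2" "K \<subseteq> F2" "F2 \<subseteq> A" for F1 F2
      using near[of F1] near[of F2] that dist_triangle2[of "sum f F1" "sum f F2" "sum f K"] by simp
    moreover have "\<forall>\<^sub>F F in finite_subsets_at_top A. finite F \<and> K \<subseteq> F \<and> F \<subseteq> A"
      unfolding eventually_finite_subsets_at_top using K by (intro exI[of _ K]) simp
    ultimately show ?thesis
      by (intro exI[of _ "\<lambda>F. finite F \<and> K \<subseteq> F \<and> F \<subseteq> A"]) blast
  qed
  then have "cauchy_filter (filtermap (sum f) (finite_subsets_at_top A))"
    by (simp add: cauchy_filter_metric_filtermap)
  then obtain L where "(sum f \<longlongrightarrow> L) (finite_subsets_at_top A)"
    using complete_uniform[where S = "UNIV :: 'a set"] complete_UNIV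
    by (force simp: filterlim_def)
  then show ?thesis
    unfolding summable_on_def has_sum_def by blast
qed

lemma bessel_on_summable:
  assumes "bessel_on g A C" "(\<lambda>i. (cmod (c i))\<^sup>2) summable_on A"
  shows "(\<lambda>i. c i *\<^sub>C g i) summable_on A"
  by (rule summable_on_norm_sq_dominated[OF assms(2), of C])
    (use assms(1) in \<open>auto simp: bessel_on_def\<close>)

text \<open>Duality: test \<open>x\<close> against the synthesis of its own coefficients.
  Cauchy-Schwarz bounds the coefficient sum by a product in which it occurs again.\<close>

lemma bessel_on_sum_le:
  assumes g: "bessel_on g A C" and F: "finite F" "F \<subseteq> A"
  shows "(\<Sum>i\<in>F. (cmod (cinner x (g i)))\<^sup>2) \<le> C * (norm x)\<^sup>2"
proof -
  define s where "s = (\<Sum>i\<in>F. cinner x (g i) *\<^sub>C g i)"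
  define a where "a = (\<Sum>i\<in>F. (cmod (cinner x (g i)))\<^sup>2)"
  have "cinner x s = complex_of_real a"
    by (simp add: s_def a_def cinner_sum_right cinner_scaleC_right complex_norm_square mult.commute
        del: of_real_power)
  moreover have "0 \<le> a" by (auto simp: a_def intro: sum_nonneg)
  ultimately have "a \<le> norm x * norm s"
    using Cauchy_Schwarz_cinner[of x s] by simp
  then have "a\<^sup>2 \<le> (norm x)\<^sup>2 * (norm s)\<^sup>2"
    using power_mono[OF _ \<open>0 \<le> a\<close>, of "norm x * norm s" 2] by (simp add: power_mult_distrib)
  also have "\<dots> \<le> (norm x)\<^sup>2 * (C * a)"
    using g F by (intro mult_left_mono) (auto simp: bessel_on_def s_def a_def)
  finally have "a * a \<le> (C * (norm x)\<^sup>2) * a"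
    by (simp add: power2_eq_square algebra_simps)
  moreover have "0 \<le> C * (norm x)\<^sup>2" using g by (simp add: bessel_on_def)
  ultimately show ?thesis
    using \<open>0 \<le> a\<close> unfolding a_def[symmetric] by - (rule le_of_mult_self_le, auto)
qed

lemma bessel_on_coeff_summable:
  assumes "bessel_on g A C"
  shows "(\<lambda>i. (cmod (cinner x (g i)))\<^sup>2) summable_on A"
  by (rule nonneg_bdd_above_summable_on) (auto intro!: bdd_aboveI2 bessel_on_sum_le[OF assms])

lemma bessel_on_infsum_le:
  assumes "bessel_on g A C"
  shows "(\<Sum>\<^sub>\<infinity>i\<in>A. (cmod (cinner x (g i)))\<^sup>2) \<le> C * (norm x)\<^sup>2"
  by (intro infsum_le_finite_sums bessel_on_coeff_summable[OF assms] bessel_on_sum_le[OF assms])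

text \<open>The converse duality. The only vector tested is the finite sum itself, which stays in
  \<open>V\<close>; hence bounds on \<open>V\<close> suffice.\<close>

lemma bessel_onI:
  assumes C: "0 \<le> C" and V: "complex_vector.subspace V" "\<And>i. i \<in> A \<Longrightarrow> g i \<in> V"
    and le: "\<And>x F. x \<in> V \<Longrightarrow> finite F \<Longrightarrow> F \<subseteq> A \<Longrightarrow>
      (\<Sum>i\<in>F. (cmod (cinner x (g i)))\<^sup>2) \<le> C * (norm x)\<^sup>2"
  shows "bessel_on g A C"
  unfolding bessel_on_def
proof (intro conjI allI impI C)
  fix c F assume F: "finite F" "F \<subseteq> A"
  define s where "s = (\<Sum>i\<in>F. c i *\<^sub>C g i)"
  define a where "a = (\<Sum>i\<in>F. (cmod (c i))\<^sup>2)"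
  have "s \<in> V"
    using F V(2) unfolding s_def
    by (intro complex_vector.subspace_sum[OF V(1)] complex_vector.subspace_scale[OF V(1)]) auto
  have "(norm s)\<^sup>2 = cmod (cinner s s)"
    by (simp add: cinner_self norm_power)
  also have "\<dots> = cmod (\<Sum>i\<in>F. c i * cinner (g i) s)"
    by (subst (1) s_def) (simp add: cinner_sum_left cinner_scaleC_left)
  also have "\<dots> \<le> (\<Sum>i\<in>F. \<bar>cmod (c i)\<bar> * \<bar>cmod (cinner s (g i))\<bar>)"
    by (rule sum_norm_le) (simp add: norm_mult cmod_cinner_commute)
  also have "\<dots> \<le> L2_set (\<lambda>i. cmod (c i)) F * L2_set (\<lambda>i. cmod (cinner s (g i))) F"
    by (rule L2_set_mult_ineq)
  finally have "((norm s)\<^sup>2)\<^sup>2 \<le> (L2_set (\<lambda>i. cmod (c i)) F * L2_set (\<lambda>i. cmod (cinner s (g i))) F)\<^sup>2"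
    by (rule power_mono) simp
  also have "\<dots> = a * (\<Sum>i\<in>F. (cmod (cinner s (g i)))\<^sup>2)"
    by (simp add: power_mult_distrib L2_set_def a_def sum_nonneg)
  also have "\<dots> \<le> a * (C * (norm s)\<^sup>2)"
    by (intro mult_left_mono le \<open>s \<in> V\<close> F) (auto simp: a_def sum_nonneg)
  finally have "(norm s)\<^sup>2 * (norm s)\<^sup>2 \<le> (C * a) * (norm s)\<^sup>2"
    by (simp add: power2_eq_square algebra_simps)
  moreover have "0 \<le> C * a" using C by (simp add: a_def sum_nonneg)
  ultimately show "(norm s)\<^sup>2 \<le> C * a"
    by - (rule le_of_mult_self_le, auto)
qed

lemma bessel_on_frame_bounds:
  assumes "frame_bounds g V A C" "complex_vector.subspace V" "range g \<subseteq> V" "0 \<le> C"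
  shows "bessel_on g UNIV C"
proof (rule bessel_onI[OF assms(4,2)])
  fix x and F :: "'a set" assume x: "x \<in> V" and F: "finite F"
  have "(\<lambda>i. (cmod (cinner x (g i)))\<^sup>2) summable_on UNIV"
    "(\<Sum>\<^sub>\<infinity>i. (cmod (cinner x (g i)))\<^sup>2) \<le> C * (norm x)\<^sup>2"
    using x assms(1) by (auto simp: frame_bounds_def)
  then show "(\<Sum>i\<in>F. (cmod (cinner x (g i)))\<^sup>2) \<le> C * (norm x)\<^sup>2"
    using finite_sum_le_infsum[of "\<lambda>i. (cmod (cinner x (g i)))\<^sup>2" UNIV F] F by auto
qed (use assms(3) in auto)

lemma bessel_on_cinner_infsum:
  assumes "bessel_on g A C" "(\<lambda>i. (cmod (c i))\<^sup>2) summable_on A"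
  shows "((\<lambda>i. c i * cinner (g i) x) has_sum cinner (\<Sum>\<^sub>\<infinity>i\<in>A. c i *\<^sub>C g i) x) A"
  using has_sum_bounded_linear[OF bounded_linear_cinner_left
      has_sum_infsum[OF bessel_on_summable[OF assms]], of x]
  by (simp add: cinner_scaleC_left)

section \<open>Analysis operators\<close>

definition analysis :: "('i \<Rightarrow> 'a::chilbert_space) \<Rightarrow> 'a \<Rightarrow> 'i ell2" where
  "analysis g x = Abs_ell2 (\<lambda>i. cinner x (g i))"

lemma ell2_coeff_analysis:
  assumes "bessel_on g UNIV C"
  shows "ell2_coeff (analysis g x) = (\<lambda>i. cinner x (g i))"
  unfolding analysis_def
  by (rule Abs_ell2_inverse) (use bessel_on_coeff_summable[OF assms] in simp)

lemma norm_analysis_sq: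
  assumes "bessel_on g UNIV C"
  shows "(norm (analysis g x))\<^sup>2 = (\<Sum>\<^sub>\<infinity>i. (cmod (cinner x (g i)))\<^sup>2)"
  by (simp add: ell2_norm_sq ell2_coeff_analysis[OF assms])

lemma norm_analysis_sq_le:
  assumes "bessel_on g UNIV C"
  shows "(norm (analysis g x))\<^sup>2 \<le> C * (norm x)\<^sup>2"
  using bessel_on_infsum_le[OF assms] by (simp add: norm_analysis_sq[OF assms])

lemma analysis_diff:
  assumes "bessel_on g UNIV C"
  shows "analysis g (x - y) = analysis g x - analysis g y"
  by (rule ell2_coeff_inject[THEN iffD1])
    (simp add: ell2_coeff_analysis[OF assms] minus_ell2.rep_eq cinner_diff_left)

text \<open>This adjoint relation takes the place of operator theory: additivity, norm bound and
  kernel of synthesis are all read off from it.\<close>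

lemma cinner_synthesis:
  assumes "bessel_on g UNIV C"
  shows "cinner (synthesis g c) x = cinner c (analysis g x)"
  unfolding synthesis_def cinner_ell2.rep_eq ell2_coeff_analysis[OF assms]
  using bessel_on_cinner_infsum[OF assms ell2_summable[of c], of x]
  by (simp add: infsumI flip: cinner_commute)

lemma norm_synthesis_sq_le:
  assumes g: "bessel_on g UNIV C"
  shows "(norm (synthesis g c))\<^sup>2 \<le> C * (norm c)\<^sup>2"
proof -
  define s where "s = synthesis g c"
  have "(norm s)\<^sup>2 = Re (cinner c (analysis g s))"
    unfolding s_def cinner_synthesis[OF g, symmetric] by (simp add: cinner_self)
  also have "\<dots> \<le> norm c * norm (analysis g s)"
    using Cauchy_Schwarz_cinner complex_Re_le_cmod order_trans by blast
  finally have "((norm s)\<^sup>2)\<^sup>2 \<le> (norm c * norm (analysis g s))\<^sup>2"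
    by (rule power_mono) simp
  also have "\<dots> \<le> (norm c)\<^sup>2 * (C * (norm s)\<^sup>2)"
    unfolding power_mult_distrib by (intro mult_left_mono norm_analysis_sq_le[OF g]) simp
  finally have "(norm s)\<^sup>2 * (norm s)\<^sup>2 \<le> (C * (norm c)\<^sup>2) * (norm s)\<^sup>2"
    by (simp add: power2_eq_square algebra_simps)
  moreover have "0 \<le> C * (norm c)\<^sup>2" using g by (simp add: bessel_on_def)
  ultimately show ?thesis
    unfolding s_def[symmetric] by - (rule le_of_mult_self_le, auto)
qed

text \<open>As an orthogonal complement the kernel is at once a closed subspace, which the dimension
  lemmas require.\<close>

lemma synthesis_kernel:
  assumes "bessel_on g UNIV C"
  shows "{c. synthesis g c = 0} = orthogonal_complement (range (analysis g))"
  by (auto simp: orthogonal_complement_def simp flip: cinner_synthesis[OF assms])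
    (metis cinner_self_eq_0)

lemma synthesis_mem:
  assumes "complex_vector.subspace V" "closed V" "range g \<subseteq> V"
  shows "synthesis g c \<in> V"
  unfolding synthesis_def
  by (rule infsum_mem_subspace[OF assms(1,2)])
    (use assms(3) in \<open>auto intro: complex_vector.subspace_scale[OF assms(1)]\<close>)

lemma frame_operator_eq:
  assumes "bessel_on g UNIV C"
  shows "frame_operator g x = synthesis g (analysis g x)"
  by (simp add: frame_operator_def synthesis_def ell2_coeff_analysis[OF assms])

lemma cinner_frame_operator:
  assumes "bessel_on g UNIV C"
  shows "cinner (frame_operator g x) z = cinner (analysis g x) (analysis g z)"
  by (simp add: frame_operator_eq[OF assms] cinner_synthesis[OF assms])

section \<open>Orthonormal families\<close>

definition orthonormal_on :: "('b \<Rightarrow> 'a::chilbert_space) \<Rightarrow> 'b set \<Rightarrow> bool" where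
  "orthonormal_on v A \<longleftrightarrow> (\<forall>i\<in>A. \<forall>j\<in>A. cinner (v i) (v j) = (if i = j then 1 else 0))"

lemma orthonormal_on_norm_sum:
  assumes v: "orthonormal_on v A" and F: "finite F" "F \<subseteq> A"
  shows "(norm (\<Sum>i\<in>F. c i *\<^sub>C v i))\<^sup>2 = (\<Sum>i\<in>F. (cmod (c i))\<^sup>2)"
proof -
  have *: "(\<Sum>j\<in>F. cnj (c j) * (c i * cinner (v i) (v j))) = cnj (c i) * c i" if "i \<in> F" for i
  proof -
    have "(\<Sum>j\<in>F. cnj (c j) * (c i * cinner (v i) (v j))) = (\<Sum>j\<in>F. if j = i then cnj (c i) * c i else 0)"
      using v F that by (intro sum.cong) (auto simp: orthonormal_on_def subset_iff)
    then show ?thesis using F that by simp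
  qed
  have "complex_of_real ((norm (\<Sum>i\<in>F. c i *\<^sub>C v i))\<^sup>2)
      = (\<Sum>i\<in>F. \<Sum>j\<in>F. cnj (c j) * (c i * cinner (v i) (v j)))"
    unfolding cinner_self[symmetric]
    by (simp only: cinner_sum_left cinner_scaleC_left)
      (simp add: cinner_sum_right cinner_scaleC_right sum_distrib_left mult_ac)
  also have "\<dots> = complex_of_real (\<Sum>i\<in>F. (cmod (c i))\<^sup>2)"
    unfolding of_real_sum complex_norm_square by (intro sum.cong) (simp_all add: * mult.commute)
  finally show ?thesis by (simp only: of_real_eq_iff)
qed

lemma bessel_on_orthonormal: "orthonormal_on v A \<Longrightarrow> bessel_on v A 1"
  by (auto simp: bessel_on_def orthonormal_on_norm_sum)

lemma orthonormal_on_infsum_coeff: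
  assumes v: "orthonormal_on v A" and c: "(\<lambda>i. (cmod (c i))\<^sup>2) summable_on A" and j: "j \<in> A"
  shows "cinner (\<Sum>\<^sub>\<infinity>i\<in>A. c i *\<^sub>C v i) (v j) = c j"
proof -
  have "cinner (\<Sum>\<^sub>\<infinity>i\<in>A. c i *\<^sub>C v i) (v j) = (\<Sum>\<^sub>\<infinity>i\<in>A. c i * cinner (v i) (v j))"
    by (rule infsumI[OF bessel_on_cinner_infsum[OF bessel_on_orthonormal[OF v] c], symmetric])
  also have "\<dots> = (\<Sum>\<^sub>\<infinity>i\<in>{j}. c i * cinner (v i) (v j))"
    by (rule infsum_cong_neutral) (use v j in \<open>auto simp: orthonormal_on_def\<close>)
  also have "\<dots> = c j"
    using v j by (simp add: orthonormal_on_def)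
  finally show ?thesis .
qed

text \<open>The residual \<open>x - p\<close> stays in \<open>V\<close> and is orthogonal to every
  \<open>v i\<close>, so totality annihilates it. The form with \<open>V\<close> and
  \<open>A\<close> serves both basis sets of subspaces and indexed bases of the whole space.\<close>

lemma orthonormal_expansion:
  assumes v: "orthonormal_on v A" and V: "complex_vector.subspace V" "closed V" "v ` A \<subseteq> V"
    and total: "\<And>x. x \<in> V \<Longrightarrow> (\<And>i. i \<in> A \<Longrightarrow> cinner x (v i) = 0) \<Longrightarrow> x = 0"
    and x: "x \<in> V"
  shows "((\<lambda>i. cinner x (v i) *\<^sub>C v i) has_sum x) A"
proof -
  note B = bessel_on_orthonormal[OF v]
  define p where "p = (\<Sum>\<^sub>\<infinity>i\<in>A. cinner x (v i) *\<^sub>C v i)"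
  have "p \<in> V"
    unfolding p_def using V
    by (intro infsum_mem_subspace) (auto intro: complex_vector.subspace_scale)
  moreover have "cinner p (v i) = cinner x (v i)" if "i \<in> A" for i
    unfolding p_def by (rule orthonormal_on_infsum_coeff[OF v bessel_on_coeff_summable[OF B] that])
  ultimately have "x - p = 0"
    using x by (intro total complex_vector.subspace_diff[OF V(1)]) (auto simp: cinner_diff_left)
  then show ?thesis
    using has_sum_infsum[OF bessel_on_summable[OF B bessel_on_coeff_summable[OF B]], of x]
    by (simp add: p_def)
qed

lemma orthonormal_parseval:
  assumes "((\<lambda>i. cinner x (v i) *\<^sub>C v i) has_sum x) A"
  shows "((\<lambda>i. cinner x (v i) * cnj (cinner z (v i))) has_sum cinner x z) A"
  using has_sum_bounded_linear[OF bounded_linear_cinner_left assms, of z]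
  by (simp add: cinner_scaleC_left flip: cinner_commute)

lemma orthonormal_parseval_norm:
  assumes "((\<lambda>i. cinner x (v i) *\<^sub>C v i) has_sum x) A"
  shows "((\<lambda>i. (cmod (cinner x (v i)))\<^sup>2) has_sum (norm x)\<^sup>2) A"
  using orthonormal_parseval[OF assms, of x]
  by (simp only: cinner_self complex_norm_square[symmetric] has_sum_of_real_iff)

section \<open>Orthonormal bases of closed subspaces\<close>

text \<open>Density of the span is traded for totality, which is easier to check and to transport:
  complements do not change under closed spans, and conversely the expansion of \<open>x\<close>
  lies in the closed span.\<close>

lemma is_onb_of_iff:
  assumes V: "complex_vector.subspace V" "closed V"
  shows "is_onb_of B V \<longleftrightarrow> orthonormal_on (\<lambda>b. b) B \<and> B \<subseteq> V \<and>
    (\<forall>x\<in>V. (\<forall>b\<in>B. cinner x b = 0) \<longrightarrow> x = 0)" (is "_ \<longleftrightarrow> ?R")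
proof
  assume B: "is_onb_of B V"
  have "x = 0" if "x \<in> V" "\<forall>b\<in>B. cinner x b = 0" for x
  proof -
    have "x \<in> orthogonal_complement (closed_cspan B)"
      unfolding orthogonal_complement_closed_cspan using that by (simp add: orthogonal_complement_def)
    then show ?thesis
      using B that by (auto simp: orthogonal_complement_def is_onb_of_def)
  qed
  then show ?R
    using B subset_closed_cspan[of B] by (auto simp: is_onb_of_def orthonormal_on_def)
next
  assume R: ?R
  have "x \<in> closed_cspan B" if "x \<in> V" for x
  proof -
    have "((\<lambda>b. cinner x b *\<^sub>C b) has_sum x) B"
      using R that by (intro orthonormal_expansion[OF _ V]) auto
    moreover have "(\<Sum>\<^sub>\<infinity>b\<in>B. cinner x b *\<^sub>C b) \<in> closed_cspan B"
      using subset_closed_cspan[of B]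
      by (intro infsum_mem_subspace subspace_closed_cspan closed_closed_cspan
          complex_vector.subspace_scale[OF subspace_closed_cspan]) auto
    ultimately show ?thesis by (simp add: infsumI)
  qed
  then show "is_onb_of B V"
    using R closed_cspan_minimal[of B V] V by (auto simp: is_onb_of_def orthonormal_on_def)
qed

lemma is_onb_of_expansion:
  assumes "is_onb_of B V" "complex_vector.subspace V" "closed V" "x \<in> V"
  shows "((\<lambda>b. cinner x b *\<^sub>C b) has_sum x) B"
  using assms by (intro orthonormal_expansion[OF _ assms(2,3)]) (auto simp: is_onb_of_iff)

lemma ex_is_onb_of:
  assumes V: "complex_vector.subspace V" "closed V"
  shows "\<exists>B. is_onb_of B V"
proof -
  let ?\<A> = "{B. B \<subseteq> V \<and> orthonormal_on (\<lambda>b. b) B}"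
  have "\<Union>\<C> \<in> ?\<A>" if "subset.chain ?\<A> \<C>" for \<C>
  proof -
    have \<C>: "B \<in> ?\<A>" if "B \<in> \<C>" for B
      using \<open>subset.chain ?\<A> \<C>\<close> that by (auto simp: subset.chain_def)
    have chain: "B \<subseteq> B' \<or> B' \<subseteq> B" if "B \<in> \<C>" "B' \<in> \<C>" for B B'
      using \<open>subset.chain ?\<A> \<C>\<close> that unfolding subset_chain_def by blast
    have "cinner x y = (if x = y then 1 else 0)" if "B \<in> \<C>" "x \<in> B" "B' \<in> \<C>" "y \<in> B'" for B B' x y
      using \<C>[OF that(1)] \<C>[OF that(3)] chain[OF that(1,3)] that(2,4)
      unfolding orthonormal_on_def by blast
    then have "orthonormal_on (\<lambda>b. b) (\<Union>\<C>)"
      unfolding orthonormal_on_def by blast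
    then show ?thesis
      using \<C> by auto
  qed
  from subset_Zorn'[of ?\<A>, OF this] obtain B
    where B: "B \<subseteq> V" "orthonormal_on (\<lambda>b. b) B"
      and max: "\<And>X. X \<subseteq> V \<Longrightarrow> orthonormal_on (\<lambda>b. b) X \<Longrightarrow> B \<subseteq> X \<Longrightarrow> X = B"
    by auto
  have "x = 0" if x: "x \<in> V" "\<forall>b\<in>B. cinner x b = 0" for x
  proof (rule ccontr)
    assume "x \<noteq> 0"
    \<comment> \<open>Normalizing a nonzero vector orthogonal to \<open>B\<close> gives an
      orthonormal set larger than the maximal one.\<close>
    define e where "e = complex_of_real (1 / norm x) *\<^sub>C x"
    have "cinner e e = 1"
      using \<open>x \<noteq> 0\<close> by (simp add: cinner_self e_def norm_scaleC norm_divide)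
    moreover have "\<forall>b\<in>B. cinner e b = 0"
      using x(2) by (simp add: e_def cinner_scaleC_left)
    moreover have "\<forall>b\<in>B. cinner b e = 0"
      using calculation(2) cinner_eq_0_commute by blast
    ultimately have "orthonormal_on (\<lambda>b. b) (insert e B)" "e \<notin> B"
      using B(2) by (auto simp: orthonormal_on_def)
    moreover have "e \<in> V"
      unfolding e_def by (rule complex_vector.subspace_scale[OF V(1) x(1)])
    ultimately show False
      using max[of "insert e B"] B(1) by auto
  qed
  then show ?thesis
    using B is_onb_of_iff[OF V] by blast
qed

text \<open>Double counting of all \<open>(cmod (cinner x b))\<^sup>2\<close>: summing over
  \<open>B\<close> first gives \<open>card F\<close> by Parseval, summing over \<open>F\<close>
  first gives at most \<open>card B\<close> by Bessel.\<close>

lemma orthonormal_card_le: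
  assumes B: "is_onb_of B V" "complex_vector.subspace V" "closed V" "finite B"
    and F: "finite F" "F \<subseteq> V" "orthonormal_on (\<lambda>b. b) F"
  shows "card F \<le> card B"
proof -
  have onB: "orthonormal_on (\<lambda>b. b) B"
    using B(1-3) by (simp add: is_onb_of_iff)
  have norm1: "(norm x)\<^sup>2 = 1" if "orthonormal_on (\<lambda>b. b) S" "x \<in> S" for x and S :: "'a set"
  proof -
    have "complex_of_real ((norm x)\<^sup>2) = 1"
      unfolding cinner_self[symmetric] using that by (simp add: orthonormal_on_def)
    then show ?thesis by (simp only: of_real_eq_1_iff)
  qed
  have "real (card F) = (\<Sum>x\<in>F. (norm x)\<^sup>2)"
    using norm1[OF F(3)] by simp
  also have "\<dots> = (\<Sum>x\<in>F. \<Sum>b\<in>B. (cmod (cinner x b))\<^sup>2)"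
  proof (rule sum.cong)
    fix x assume "x \<in> F"
    then have "((\<lambda>b. (cmod (cinner x b))\<^sup>2) has_sum (norm x)\<^sup>2) B"
      using F(2) by (intro orthonormal_parseval_norm is_onb_of_expansion[OF B(1-3)]) auto
    then show "(norm x)\<^sup>2 = (\<Sum>b\<in>B. (cmod (cinner x b))\<^sup>2)"
      using B(4) by (metis has_sum_finite has_sum_unique)
  qed simp
  also have "\<dots> = (\<Sum>b\<in>B. \<Sum>x\<in>F. (cmod (cinner b x))\<^sup>2)"
    by (subst sum.swap) (simp only: cmod_cinner_commute)
  also have "\<dots> \<le> (\<Sum>b\<in>B. 1 * (norm b)\<^sup>2)"
    by (intro sum_mono bessel_on_sum_le[OF bessel_on_orthonormal[OF F(3)]] F(1) order.refl)
  also have "\<dots> = real (card B)"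
    using norm1[OF onB] by simp
  finally show ?thesis by simp
qed

text \<open>This makes the definite description in \<open>hilbert_dim\<close> meaningful. Finiteness
  passes to \<open>B'\<close> because the cardinalities of its finite subsets are bounded by
  \<open>card B\<close>.\<close>

lemma is_onb_of_card_unique:
  assumes V: "complex_vector.subspace V" "closed V"
    and B: "is_onb_of B V" "is_onb_of B' V" "finite B"
  shows "finite B' \<and> card B' = card B"
proof -
  have on: "orthonormal_on (\<lambda>b. b) B" "B \<subseteq> V" "orthonormal_on (\<lambda>b. b) B'" "B' \<subseteq> V"
    using B(1,2) by (simp_all add: is_onb_of_iff[OF V])
  have le: "card F \<le> card B" if "finite F" "F \<subseteq> B'" for F
  proof (rule orthonormal_card_le[OF B(1) V B(3) that(1)])
    show "F \<subseteq> V" using that on(4) by blast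
    show "orthonormal_on (\<lambda>b. b) F" using that on(3) unfolding orthonormal_on_def by blast
  qed
  have fin: "finite B'"
    using finite_if_finite_subsets_card_bdd[of B' "card B"] le by blast
  moreover have "card B' \<le> card B"
    by (rule le[OF fin order.refl])
  moreover have "card B \<le> card B'"
    by (rule orthonormal_card_le[OF B(2) V fin B(3) on(2,1)])
  ultimately show ?thesis by simp
qed

lemma hilbert_dim_eq:
  assumes V: "complex_vector.subspace V" "closed V" and B: "is_onb_of B V"
  shows "hilbert_dim V = (if finite B then enat (card B) else \<infinity>)"
  unfolding hilbert_dim_def
proof (rule the_equality)
  fix n assume "\<exists>B. is_onb_of B V \<and> n = (if finite B then enat (card B) else \<infinity>)"
  then obtain B' where B': "is_onb_of B' V" and n: "n = (if finite B' then enat (card B') else \<infinity>)"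
    by blast
  show "n = (if finite B then enat (card B) else \<infinity>)"
    using is_onb_of_card_unique[OF V B B'] is_onb_of_card_unique[OF V B' B] unfolding n
    by presburger
qed (use B in blast)

text \<open>By Bessel each \<open>g i\<close> has nonzero coefficients at only countably many
  elements of \<open>B\<close>, and totality ensures that every element is met by some
  \<open>g i\<close>.\<close>

lemma orthonormal_countable:
  fixes g :: "'i::countable \<Rightarrow> 'a::chilbert_space" and B :: "'a set"
  assumes B: "orthonormal_on (\<lambda>b. b) B" and total: "\<And>x. (\<And>i. cinner x (g i) = 0) \<Longrightarrow> x = 0"
  shows "countable B"
proof (rule countable_subset)
  show "B \<subseteq> (\<Union>i. {b\<in>B. (cmod (cinner (g i) b))\<^sup>2 \<noteq> 0})"
  proof
    fix b assume b: "b \<in> B"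
    then have "cinner b b = 1"
      using B by (simp add: orthonormal_on_def)
    then have "b \<noteq> 0" by auto
    then obtain i where "cinner b (g i) \<noteq> 0"
      using total by blast
    then show "b \<in> (\<Union>i. {b\<in>B. (cmod (cinner (g i) b))\<^sup>2 \<noteq> 0})"
      using b by (auto simp: cmod_cinner_commute[of "g _"])
  qed
  show "countable (\<Union>i. {b\<in>B. (cmod (cinner (g i) b))\<^sup>2 \<noteq> 0})"
    by (intro countable_UN summable_countable_real
        bessel_on_coeff_summable[OF bessel_on_orthonormal[OF B]]) simp
qed

text \<open>Injectivity on the basis, orthonormality and totality of its image all follow from
  preserved inner products, so the image of a basis is again a basis.\<close>

lemma hilbert_dim_isometry_image:
  fixes V :: "'a::chilbert_space set" and V' :: "'b::chilbert_space set"
  assumes V: "complex_vector.subspace V" "closed V" and V': "complex_vector.subspace V'" "closed V'"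
    and J: "J ` V = V'" "\<And>x y. x \<in> V \<Longrightarrow> y \<in> V \<Longrightarrow> cinner (J x) (J y) = cinner x y"
  shows "hilbert_dim V' = hilbert_dim V"
proof -
  obtain B where B: "is_onb_of B V"
    using ex_is_onb_of[OF V] by blast
  then have onB: "orthonormal_on (\<lambda>b. b) B" "B \<subseteq> V"
    "\<And>x. x \<in> V \<Longrightarrow> (\<And>b. b \<in> B \<Longrightarrow> cinner x b = 0) \<Longrightarrow> x = 0"
    by (auto simp: is_onb_of_iff[OF V])
  have "inj_on J B"
  proof (rule inj_onI)
    fix x y assume "x \<in> B" "y \<in> B" "J x = J y"
    then have "cinner x y = cinner x x"
      using J(2) onB(2) by (metis subsetD)
    then show "x = y"
      using onB(1) \<open>x \<in> B\<close> \<open>y \<in> B\<close> by (auto simp: orthonormal_on_def split: if_splits)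
  qed
  moreover have "is_onb_of (J ` B) V'"
    unfolding is_onb_of_iff[OF V']
  proof (intro conjI ballI impI)
    show "orthonormal_on (\<lambda>b. b) (J ` B)"
      using onB(1,2) J(2) \<open>inj_on J B\<close> by (auto simp: orthonormal_on_def subset_iff inj_on_def)
    fix z assume "z \<in> V'" and z: "\<forall>b\<in>J ` B. cinner z b = 0"
    then obtain x where x: "x \<in> V" "z = J x" using J(1) by auto
    then have "x = 0"
      using z onB(2) J(2) by (intro onB(3)) (auto simp: subset_iff)
    then have "cinner z z = 0" using x J(2) by simp
    then show "z = 0" by simp
  qed (use onB(2) J(1) in auto)
  ultimately show ?thesis
    by (simp add: hilbert_dim_eq[OF V B] hilbert_dim_eq[OF V'] finite_image_iff card_image)
qed

lemma ex_isometry_of_hilbert_dim_eq: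
  fixes V :: "'a::chilbert_space set" and V' :: "'b::chilbert_space set"
    and g :: "'i::countable \<Rightarrow> 'a" and g' :: "'j::countable \<Rightarrow> 'b"
  assumes V: "complex_vector.subspace V" "closed V" and V': "complex_vector.subspace V'" "closed V'"
    and total: "\<And>x. (\<And>i. cinner x (g i) = 0) \<Longrightarrow> x = 0" "\<And>x. (\<And>i. cinner x (g' i) = 0) \<Longrightarrow> x = 0"
    and dim: "hilbert_dim V = hilbert_dim V'"
  obtains J where "J ` V = V'" "\<And>x y. x \<in> V \<Longrightarrow> y \<in> V \<Longrightarrow> cinner (J x) (J y) = cinner x y"
proof -
  obtain B B' where B: "is_onb_of B V" and B': "is_onb_of B' V'"
    using ex_is_onb_of V V' by metis
  have on: "orthonormal_on (\<lambda>b. b) B" "B \<subseteq> V" "orthonormal_on (\<lambda>b. b) B'" "B' \<subseteq> V'"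
    using B B' by (simp_all add: is_onb_of_iff V V')
  have "countable B" "countable B'"
    by (rule orthonormal_countable[OF on(1) total(1)] orthonormal_countable[OF on(3) total(2)];
        assumption)+
  moreover have "(if finite B then enat (card B) else \<infinity>) = (if finite B' then enat (card B') else \<infinity>)"
    using dim by (simp only: hilbert_dim_eq[OF V B] hilbert_dim_eq[OF V' B'])
  \<comment> \<open>A finite and an infinite basis would have different dimensions; two infinite
    ones are both countable and are matched through the natural numbers.\<close>
  ultimately have "\<exists>\<beta>. bij_betw \<beta> B B'"
    by (cases "finite B"; cases "finite B'")
      (auto intro: finite_same_card_bij bij_betw_trans[OF to_nat_on_infinite
          bij_betw_from_nat_into])
  then obtain \<beta> where \<beta>: "bij_betw \<beta> B B'" by blast
  have on\<beta>: "orthonormal_on \<beta> B"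
    using \<beta> on(3) by (auto simp: orthonormal_on_def bij_betw_def inj_on_def)
  \<comment> \<open>\<open>J\<close> keeps the coordinates and replaces each basis vector
    \<open>b\<close> by its partner; isometry is then Parseval on both sides.\<close>
  define J where "J x = (\<Sum>\<^sub>\<infinity>b\<in>B. cinner x b *\<^sub>C \<beta> b)" for x
  note coeff = bessel_on_coeff_summable[OF bessel_on_orthonormal[OF on(1)]]
  have J\<beta>: "cinner (J x) (\<beta> b) = cinner x b" if "b \<in> B" for x b
    unfolding J_def by (rule orthonormal_on_infsum_coeff[OF on\<beta> coeff that])
  have JV: "J x \<in> V'" for x
    unfolding J_def using \<beta> on(4)
    by (intro infsum_mem_subspace V' complex_vector.subspace_scale[OF V'(1)]) (auto simp: bij_betw_def)
  have exp\<beta>: "((\<lambda>b. cinner z (\<beta> b) *\<^sub>C \<beta> b) has_sum z) B" if "z \<in> V'" for z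
    using is_onb_of_expansion[OF B' V' that] has_sum_reindex_bij_betw[OF \<beta>, of "\<lambda>b. cinner z b *\<^sub>C b" z]
    by simp
  show thesis
  proof
    show "cinner (J x) (J y) = cinner x y" if "x \<in> V" "y \<in> V" for x y
    proof -
      have "((\<lambda>b. cinner x b * cnj (cinner y b)) has_sum cinner (J x) (J y)) B"
        using orthonormal_parseval[OF exp\<beta>[OF JV[of x]], of "J y"]
        by (simp add: J\<beta> cong: has_sum_cong)
      then show ?thesis
        using orthonormal_parseval[OF is_onb_of_expansion[OF B V that(1)]] has_sum_unique by blast
    qed
    show "J ` V = V'"
    proof
      show "V' \<subseteq> J ` V"
      proof
        fix z assume z: "z \<in> V'"
        define x where "x = (\<Sum>\<^sub>\<infinity>b\<in>B. cinner z (\<beta> b) *\<^sub>C b)"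
        have "x \<in> V"
          unfolding x_def using on(2)
          by (intro infsum_mem_subspace V complex_vector.subspace_scale[OF V(1)]) auto
        have "cinner x b = cinner z (\<beta> b)" if "b \<in> B" for b
          unfolding x_def using that bessel_on_coeff_summable[OF bessel_on_orthonormal[OF on\<beta>]]
          by (intro orthonormal_on_infsum_coeff[OF on(1)])
        then have "J x = z"
          unfolding J_def using exp\<beta>[OF z] by (simp add: infsumI cong: infsum_cong)
        then show "z \<in> J ` V" using \<open>x \<in> V\<close> by blast
      qed
    qed (use JV in blast)
  qed
qed

section \<open>Frame sequences and their canonical duals\<close>

text \<open>The upper bound is kept for the whole space, since coefficients are also taken of
  vectors outside the span; the lower bound can only hold on the span.\<close>

locale frame_sequence =
  fixes w :: "'i \<Rightarrow> 'a::chilbert_space" and A B :: real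
  assumes bounds: "0 < A" "A \<le> B"
    and bessel: "bessel_on w UNIV B"
    and lower: "x \<in> closed_cspan (range w) \<Longrightarrow> A * (norm x)\<^sup>2 \<le> (norm (analysis w x))\<^sup>2"
begin

abbreviation W :: "'a set" where "W \<equiv> closed_cspan (range w)"

lemma mem_W: "w i \<in> W"
  using subset_closed_cspan[of "range w"] by (simp add: subset_iff)

lemma frame_operator_mem: "frame_operator w x \<in> W"
  unfolding frame_operator_eq[OF bessel]
  by (rule synthesis_mem[OF subspace_closed_cspan closed_closed_cspan subset_closed_cspan])

lemma cinner_frame_operator_commute:
  "cinner (frame_operator w x) z = cinner x (frame_operator w z)"
  using cinner_frame_operator[OF bessel, of x z] cinner_frame_operator[OF bessel, of z x]
  by (metis cinner_commute)

lemma frame_operator_diff: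
  "frame_operator w (x - y) = frame_operator w x - frame_operator w y"
  by (rule cinner_ext)
    (simp add: cinner_frame_operator[OF bessel] cinner_diff_left analysis_diff[OF bessel])

lemma inner_frame_operator: "inner x (frame_operator w x) = (norm (analysis w x))\<^sup>2"
  unfolding inner_cinner cinner_frame_operator_commute[symmetric]
  by (simp add: cinner_frame_operator[OF bessel] cinner_self)

lemma norm_frame_operator_sq_le: "(norm (frame_operator w x))\<^sup>2 \<le> B\<^sup>2 * (norm x)\<^sup>2"
proof -
  have "(norm (frame_operator w x))\<^sup>2 \<le> B * (norm (analysis w x))\<^sup>2"
    unfolding frame_operator_eq[OF bessel] by (rule norm_synthesis_sq_le[OF bessel])
  also have "\<dots> \<le> B * (B * (norm x)\<^sup>2)"
    using bounds by (intro mult_left_mono norm_analysis_sq_le[OF bessel]) auto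
  finally show ?thesis by (simp add: power2_eq_square mult.assoc)
qed

lemma norm_frame_operator_ge:
  assumes "x \<in> W"
  shows "A * norm x \<le> norm (frame_operator w x)"
proof -
  have "A * (norm x)\<^sup>2 \<le> inner x (frame_operator w x)"
    unfolding inner_frame_operator by (rule lower[OF assms])
  also have "\<dots> \<le> norm x * norm (frame_operator w x)"
    by (rule norm_cauchy_schwarz)
  finally have "norm x * (A * norm x) \<le> norm x * norm (frame_operator w x)"
    by (simp add: power2_eq_square algebra_simps)
  then show ?thesis by (cases "x = 0") auto
qed

text \<open>
  For \<open>t = A / B\<^sup>2\<close> the map \<open>x \<mapsto> x + t (z - S x)\<close> contracts the square of the norm by the
  factor \<open>1 - A\<^sup>2 / B\<^sup>2\<close>, so it has a fixed point in \<open>W\<close>.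
\<close>

lemma frame_operator_surj:
  assumes "z \<in> W"
  obtains x where "x \<in> W" "frame_operator w x = z"
proof -
  let ?S = "frame_operator w"
  \<comment> \<open>This value minimizes \<open>1 - 2 * t * A + t\<^sup>2 * B\<^sup>2\<close>, the
    factor obtained below from the frame bounds; the minimum is \<open>q\<close>.\<close>
  define t where "t = A / B\<^sup>2"
  define q where "q = 1 - A\<^sup>2 / B\<^sup>2"
  define \<phi> where "\<phi> x = x + t *\<^sub>R (z - ?S x)" for x
  have pos: "0 < t" "0 < B"
    using bounds by (auto simp: t_def)
  have "A\<^sup>2 \<le> B\<^sup>2" using bounds by (intro power_mono) auto
  then have q: "0 \<le> q" "q < 1"
    using bounds by (auto simp: q_def)
  have contr: "(norm (d - t *\<^sub>R ?S d))\<^sup>2 \<le> q * (norm d)\<^sup>2" if "d \<in> W" for d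
  proof -
    have "(norm (d - t *\<^sub>R ?S d))\<^sup>2 =
        (norm d)\<^sup>2 - 2 * t * (norm (analysis w d))\<^sup>2 + t\<^sup>2 * (norm (?S d))\<^sup>2"
      using inner_frame_operator[of d] unfolding power2_norm_eq_inner
      by (simp add: inner_diff_left inner_diff_right inner_commute[of "?S d" d]
          power2_eq_square algebra_simps)
    also have "\<dots> \<le> (norm d)\<^sup>2 - 2 * t * (A * (norm d)\<^sup>2) + t\<^sup>2 * (B\<^sup>2 * (norm d)\<^sup>2)"
      using pos by (intro add_mono diff_mono mult_left_mono lower that norm_frame_operator_sq_le) auto
    also have "\<dots> = (1 - 2 * t * A + t\<^sup>2 * B\<^sup>2) * (norm d)\<^sup>2"
      by (simp add: algebra_simps)
    also have "1 - 2 * t * A + t\<^sup>2 * B\<^sup>2 = q"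
      using pos by (simp add: t_def q_def power2_eq_square field_simps)
    finally show ?thesis .
  qed
  have "\<exists>!x\<in>W. \<phi> x = x"
  proof (rule Banach_fix)
    show "complete W" by (simp add: complete_eq_closed closed_closed_cspan)
    show "W \<noteq> {}" using assms by blast
    \<comment> \<open>The contraction estimate concerns squared norms, hence the square
      root.\<close>
    show "0 \<le> sqrt q" "sqrt q < 1" using q by auto
    show "\<phi> ` W \<subseteq> W"
      using assms frame_operator_mem
      by (auto simp: \<phi>_def scaleR_scaleC intro!: complex_vector.subspace_add[OF subspace_closed_cspan]
          complex_vector.subspace_diff[OF subspace_closed_cspan]
          complex_vector.subspace_scale[OF subspace_closed_cspan])
    fix x y assume "x \<in> W" "y \<in> W"
    then have d: "x - y \<in> W"
      by (rule complex_vector.subspace_diff[OF subspace_closed_cspan])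
    have "\<phi> x - \<phi> y = (x - y) - t *\<^sub>R ?S (x - y)"
      by (simp add: \<phi>_def frame_operator_diff algebra_simps)
    then have "(dist (\<phi> x) (\<phi> y))\<^sup>2 \<le> q * (dist x y)\<^sup>2"
      using contr[OF d] by (simp add: dist_norm)
    then have "(dist (\<phi> x) (\<phi> y))\<^sup>2 \<le> (sqrt q * dist x y)\<^sup>2"
      using q by (simp add: power_mult_distrib)
    then show "dist (\<phi> x) (\<phi> y) \<le> sqrt q * dist x y"
      by (rule power2_le_imp_le) (simp add: q)
  qed
  then obtain x where "x \<in> W" "\<phi> x = x" by blast
  then show thesis
    using pos that by (auto simp: \<phi>_def)
qed

lemma canonical_dual:
  shows canonical_dual_mem: "canonical_dual w k \<in> W"
    and frame_operator_canonical_dual: "frame_operator w (canonical_dual w k) = w k"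
proof -
  have "w k \<in> frame_operator w ` W"
    using frame_operator_surj[OF mem_W] by (metis imageI)
  then show "canonical_dual w k \<in> W" "frame_operator w (canonical_dual w k) = w k"
    unfolding canonical_dual_def by (rule inv_into_into, rule f_inv_into_f)
qed

text \<open>If \<open>x\<close> is the image of \<open>x'\<close> under the frame operator, the dual
  coefficients of \<open>x\<close> are the coefficients of \<open>x'\<close> with respect to
  \<open>w\<close>. The factor \<open>B\<close> is the Bessel bound of \<open>w\<close>, and
  \<open>1 / A\<^sup>2\<close> is the price of returning from \<open>x'\<close> to
  \<open>x\<close>.\<close>

lemma bessel_canonical_dual: "bessel_on (canonical_dual w) UNIV (B / A\<^sup>2)"
proof (rule bessel_onI[OF _ subspace_closed_cspan canonical_dual_mem])
  show "0 \<le> B / A\<^sup>2" using bounds by simp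
  fix x and F :: "'i set" assume "x \<in> W" and F: "finite F" "F \<subseteq> UNIV"
  then obtain x' where x': "x' \<in> W" "frame_operator w x' = x"
    using frame_operator_surj by blast
  have "(\<Sum>k\<in>F. (cmod (cinner x (canonical_dual w k)))\<^sup>2) = (\<Sum>k\<in>F. (cmod (cinner x' (w k)))\<^sup>2)"
    by (simp add: cinner_frame_operator_commute frame_operator_canonical_dual flip: x'(2))
  also have "\<dots> \<le> B * (norm x')\<^sup>2"
    by (rule bessel_on_sum_le[OF bessel F])
  also have "\<dots> = B / A\<^sup>2 * (A * norm x')\<^sup>2"
    using bounds by (simp add: power_mult_distrib)
  also have "\<dots> \<le> B / A\<^sup>2 * (norm x)\<^sup>2"
    using bounds norm_frame_operator_ge[OF x'(1)] unfolding x'(2)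
    by (intro mult_left_mono power_mono) auto
  finally show "(\<Sum>k\<in>F. (cmod (cinner x (canonical_dual w k)))\<^sup>2) \<le> B / A\<^sup>2 * (norm x)\<^sup>2" .
qed

lemma infsum_canonical_dual_mem: "(\<Sum>\<^sub>\<infinity>k. c k *\<^sub>C canonical_dual w k) \<in> W"
  by (intro infsum_mem_subspace subspace_closed_cspan closed_closed_cspan canonical_dual_mem
      complex_vector.subspace_scale[OF subspace_closed_cspan])

text \<open>The series is the orthogonal projection of an arbitrary \<open>g\<close> to
  \<open>W\<close>, in weak form. Writing \<open>z\<close> as an image of the frame operator and
  moving that operator to the dual vectors turns them back into \<open>w k\<close>.\<close>

lemma cinner_canonical_dual_expansion:
  assumes "z \<in> W"
  shows "cinner (\<Sum>\<^sub>\<infinity>k. cinner g (w k) *\<^sub>C canonical_dual w k) z = cinner g z"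
proof -
  obtain x where x: "frame_operator w x = z"
    using frame_operator_surj[OF assms] by blast
  have "cinner (\<Sum>\<^sub>\<infinity>k. cinner g (w k) *\<^sub>C canonical_dual w k) z
      = (\<Sum>\<^sub>\<infinity>k. cinner g (w k) * cinner (canonical_dual w k) z)"
    by (rule infsumI[OF bessel_on_cinner_infsum[OF bessel_canonical_dual
            bessel_on_coeff_summable[OF bessel]], symmetric])
  also have "\<dots> = (\<Sum>\<^sub>\<infinity>k. cinner g (w k) * cnj (cinner x (w k)))"
    unfolding x[symmetric] cinner_frame_operator_commute[symmetric] frame_operator_canonical_dual
    by (simp flip: cinner_commute)
  also have "\<dots> = cinner (analysis w g) (analysis w x)"
    by (simp add: cinner_ell2.rep_eq ell2_coeff_analysis[OF bessel])
  also have "\<dots> = cinner g z"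
    unfolding x[symmetric] cinner_frame_operator_commute[symmetric]
    by (rule cinner_frame_operator[OF bessel, symmetric])
  finally show ?thesis .
qed

end

lemma is_frame_sequenceE:
  assumes "is_frame_sequence w"
  obtains A B where "frame_sequence w A B"
proof -
  obtain A B where AB: "0 < A" "A \<le> B" "frame_bounds w (closed_cspan (range w)) A B"
    using assms by (auto simp: is_frame_sequence_def is_frame_def)
  have bessel: "bessel_on w UNIV B"
    by (rule bessel_on_frame_bounds[OF AB(3) subspace_closed_cspan subset_closed_cspan])
      (use AB in auto)
  show thesis
  proof (rule that, unfold_locales)
    show "A * (norm x)\<^sup>2 \<le> (norm (analysis w x))\<^sup>2" if "x \<in> closed_cspan (range w)" for x
      using AB(3) that by (simp add: norm_analysis_sq[OF bessel] frame_bounds_def)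
  qed (use AB bessel in auto)
qed

section \<open>Parseval frames\<close>

lemma bessel_on_parseval:
  assumes "is_parseval_frame y V" "complex_vector.subspace V"
  shows "bessel_on y UNIV 1"
  using assms bessel_on_frame_bounds[of y V 1 1] by (auto simp: is_parseval_frame_def)

lemma norm_analysis_parseval:
  assumes "is_parseval_frame y V" "complex_vector.subspace V" "x \<in> V"
  shows "(norm (analysis y x))\<^sup>2 = (norm x)\<^sup>2"
  using assms
  by (simp add: norm_analysis_sq[OF bessel_on_parseval] is_parseval_frame_def frame_bounds_def
      order_antisym)

text \<open>The norm of \<open>s\<close> is at most that of \<open>x\<close>, while
  \<open>inner s x\<close> already equals \<open>(norm x)\<^sup>2\<close>; expanding
  \<open>(norm (s - x))\<^sup>2\<close> leaves no room for a difference.\<close>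

lemma synthesis_analysis_parseval:
  assumes y: "is_parseval_frame y V" and V: "complex_vector.subspace V" and x: "x \<in> V"
  shows "synthesis y (analysis y x) = x"
proof -
  note B = bessel_on_parseval[OF y V]
  define s where "s = synthesis y (analysis y x)"
  have "(norm s)\<^sup>2 \<le> (norm x)\<^sup>2"
    using norm_synthesis_sq_le[OF B, of "analysis y x"] norm_analysis_parseval[OF y V x]
    by (simp add: s_def)
  moreover have "inner s x = (norm x)\<^sup>2"
    unfolding inner_cinner s_def cinner_synthesis[OF B]
    using norm_analysis_parseval[OF y V x] by (simp add: cinner_self flip: of_real_power)
  ultimately have "(norm (s - x))\<^sup>2 \<le> 0"
    by (simp add: power2_norm_eq_inner inner_diff_left inner_diff_right inner_commute)
  then show ?thesis by (simp add: s_def)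
qed

section \<open>Indexed orthonormal bases and the scalar forms of the two matrix conditions\<close>

lemma orthonormal_basis_iff:
  "orthonormal_basis v \<longleftrightarrow> orthonormal_on v UNIV \<and> (\<forall>x. (\<forall>i. cinner x (v i) = 0) \<longrightarrow> x = 0)"
proof (cases "orthonormal_on v UNIV")
  case True
  then have "orthonormal_on (\<lambda>b. b) (range v)"
    by (auto simp: orthonormal_on_def) (metis zero_neq_one)
  then have "closed_cspan (range v) = UNIV \<longleftrightarrow> is_onb_of (range v) UNIV"
    by (simp add: is_onb_of_def orthonormal_on_def)
  then show ?thesis
    using True \<open>orthonormal_on (\<lambda>b. b) (range v)\<close> is_onb_of_iff[of UNIV "range v"]
    by (simp add: orthonormal_basis_def orthonormal_on_def)
next
  case False
  then show ?thesis unfolding orthonormal_basis_def orthonormal_on_def by blast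
qed

lemma orthonormal_basis_expansion:
  assumes "orthonormal_basis v"
  shows "((\<lambda>i. cinner x (v i) *\<^sub>C v i) has_sum x) UNIV"
  using assms unfolding orthonormal_basis_iff
  by (intro orthonormal_expansion[where V = UNIV]) auto

lemma orthonormal_basis_parseval_frame:
  assumes "orthonormal_basis v"
  shows "is_parseval_frame v UNIV"
proof -
  note * = orthonormal_parseval_norm[OF orthonormal_basis_expansion[OF assms]]
  show ?thesis
    using *[THEN has_sum_imp_summable] *[THEN infsumI]
    by (simp add: is_parseval_frame_def frame_bounds_def)
qed

lemma cinner_synthesis_orthonormal:
  assumes "orthonormal_on v UNIV"
  shows "cinner (synthesis v c) (synthesis v d) = cinner c d"
proof -
  note B = bessel_on_orthonormal[OF assms]
  have "analysis v (synthesis v d) = d"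
    by (rule ell2_coeff_inject[THEN iffD1])
      (simp add: ell2_coeff_analysis[OF B] synthesis_def fun_eq_iff
        orthonormal_on_infsum_coeff[OF assms ell2_summable])
  then show ?thesis by (simp add: cinner_synthesis[OF B])
qed

text \<open>The Gram matrix of an orthonormal basis is the identity, which settles the matrix
  equation; the series for \<open>w j\<close> amounts to prescribing its coefficients.\<close>

lemma weak_R_dual_orthonormal_iff:
  assumes v: "orthonormal_basis v" and u: "is_parseval_frame u UNIV"
    and f: "bessel_on f UNIV C"
  shows "is_weak_R_dual w f u v \<longleftrightarrow> (\<forall>i j. cinner (w j) (v i) = cinner (f i) (u j))"
proof -
  have on: "orthonormal_on v UNIV"
    using v by (simp add: orthonormal_basis_iff)
  have fu: "(\<lambda>i. (cmod (cinner (f i) (u j)))\<^sup>2) summable_on UNIV" for j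
    using bessel_on_coeff_summable[OF f] by (simp add: cmod_cinner_commute[of "f _"])
  have "imat_transpose (gram_matrix v v) = imat_id"
    using on by (auto simp: imat_transpose_def gram_matrix_def imat_id_def orthonormal_on_def fun_eq_iff)
  then have "imat_mult (imat_transpose (gram_matrix v v) - imat_id) (gram_matrix f u) = (\<lambda>_ _. 0)"
    by (simp add: imat_mult_def)
  then have "is_weak_R_dual w f u v \<longleftrightarrow> (\<forall>j. w j = (\<Sum>\<^sub>\<infinity>i. cinner (f i) (u j) *\<^sub>C v i))"
    using u orthonormal_basis_parseval_frame[OF v] fu by (simp add: is_weak_R_dual_def)
  moreover have "w j = (\<Sum>\<^sub>\<infinity>i. cinner (f i) (u j) *\<^sub>C v i) \<longleftrightarrow>
      (\<forall>i. cinner (w j) (v i) = cinner (f i) (u j))" for j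
  proof
    assume "\<forall>i. cinner (w j) (v i) = cinner (f i) (u j)"
    then show "w j = (\<Sum>\<^sub>\<infinity>i. cinner (f i) (u j) *\<^sub>C v i)"
      using orthonormal_basis_expansion[OF v, of "w j"] by (simp add: infsumI)
  qed (simp add: orthonormal_on_infsum_coeff[OF on fu])
  ultimately show ?thesis by blast
qed

lemma gram_condition_iff:
  assumes w': "bessel_on w' UNIV C" and c: "\<And>i. (\<lambda>k. (cmod (cinner (u k) (f i)))\<^sup>2) summable_on UNIV"
    and y: "\<And>i. y i = (\<Sum>\<^sub>\<infinity>k. cinner (u k) (f i) *\<^sub>C w' k)"
  shows "imat_mult (imat_transpose (gram_matrix w' w) - imat_id) (gram_matrix u f) = (\<lambda>_ _. 0) \<longleftrightarrow>
    (\<forall>i j. cinner (y i) (w j) = cinner (u j) (f i))"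
proof -
  have "imat_mult (imat_transpose (gram_matrix w' w) - imat_id) (gram_matrix u f) j i
      = cinner (y i) (w j) - cinner (u j) (f i)" for i j
  proof -
    \<comment> \<open>The identity is subtracted inside the infinite sum, so both parts must be
      summable; the identity row contributes the single term at \<open>j\<close>.\<close>
    have "((\<lambda>k. imat_id j k * cinner (u k) (f i)) has_sum cinner (u j) (f i)) UNIV"
      by (rule has_sum_finite_neutralI[of "{j}"]) (auto simp: imat_id_def)
    then have "((\<lambda>k. cinner (u k) (f i) * cinner (w' k) (w j) + - (imat_id j k * cinner (u k) (f i)))
        has_sum cinner (y i) (w j) + - cinner (u j) (f i)) UNIV"
      unfolding y by (intro has_sum_add has_sum_uminusI bessel_on_cinner_infsum[OF w' c])
    then show ?thesis
      unfolding imat_mult_def by (intro infsumI) (simp add: imat_transpose_def gram_matrix_def algebra_simps)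
  qed
  then show ?thesis by (auto simp: fun_eq_iff)
qed

section \<open>Completing Parseval frames to orthonormal bases\<close>

text \<open>The assumptions say that \<open>y i\<close> is the projection of \<open>v i\<close> to
  \<open>V\<close>. On \<open>V\<close> both families have the same coefficients, whence
  Parseval.\<close>

lemma hilbert_dim_kernel_of_projected_basis:
  assumes v: "orthonormal_basis v" and V: "complex_vector.subspace V" "closed V"
    and y: "range y \<subseteq> V" "\<And>i z. z \<in> V \<Longrightarrow> cinner (y i) z = cinner (v i) z"
  shows "is_parseval_frame y V"
    and "hilbert_dim {c. synthesis y c = 0} = hilbert_dim (orthogonal_complement V)"
proof -
  have on: "orthonormal_on v UNIV"
    using v by (simp add: orthonormal_basis_iff)
  note Bv = bessel_on_orthonormal[OF on]
  have eq: "cinner z (y i) = cinner z (v i)" if "z \<in> V" for z i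
    using y(2)[OF that] by (metis cinner_commute)
  show parseval: "is_parseval_frame y V"
    using orthonormal_basis_parseval_frame[OF v] y(1)
    by (simp add: is_parseval_frame_def frame_bounds_def eq)
  note By = bessel_on_parseval[OF parseval V(1)]
  \<comment> \<open>Thus \<open>synthesis y c\<close> is the projection of
    \<open>synthesis v c\<close> to \<open>V\<close>, and vanishes exactly if the latter is
    orthogonal to \<open>V\<close>.\<close>
  have adj: "cinner (synthesis y c) z = cinner (synthesis v c) z" if "z \<in> V" for c z
  proof -
    have "analysis y z = analysis v z"
      by (simp add: analysis_def eq that)
    then show ?thesis by (simp add: cinner_synthesis[OF By] cinner_synthesis[OF Bv])
  qed
  have "synthesis v ` {c. synthesis y c = 0} = orthogonal_complement V"
  proof
    show "synthesis v ` {c. synthesis y c = 0} \<subseteq> orthogonal_complement V"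
      by (auto simp: orthogonal_complement_def simp flip: adj)
    show "orthogonal_complement V \<subseteq> synthesis v ` {c. synthesis y c = 0}"
    proof
      fix x assume x: "x \<in> orthogonal_complement V"
      have vx: "synthesis v (analysis v x) = x"
        by (rule synthesis_analysis_parseval[OF orthonormal_basis_parseval_frame[OF v]]) auto
      have "synthesis y (analysis v x) \<in> V"
        by (rule synthesis_mem[OF V y(1)])
      then have "cinner (synthesis y (analysis v x)) (synthesis y (analysis v x)) = 0"
        using x by (subst adj) (auto simp: vx orthogonal_complement_def)
      then have "synthesis y (analysis v x) = 0" by simp
      then show "x \<in> synthesis v ` {c. synthesis y c = 0}"
        using vx by (metis (mono_tags) imageI mem_Collect_eq)
    qed
  qed
  then show "hilbert_dim {c. synthesis y c = 0} = hilbert_dim (orthogonal_complement V)"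
    using hilbert_dim_isometry_image[of "{c. synthesis y c = 0}" "orthogonal_complement V" "synthesis v"]
    by (simp add: synthesis_kernel[OF By] subspace_orthogonal_complement closed_orthogonal_complement
        cinner_synthesis_orthonormal[OF on])
qed

lift_definition ell2_unit :: "'i \<Rightarrow> 'i ell2" is "\<lambda>i j. if j = i then 1 else 0"
  by (rule summable_on_cong_neutral[THEN iffD1, OF _ _ _ summable_on_finite[of "{_}"]]) auto

lemma cinner_ell2_unit: "cinner c (ell2_unit i) = ell2_coeff c i"
proof -
  have "((\<lambda>j. ell2_coeff c j * cnj (if j = i then 1 else 0)) has_sum ell2_coeff c i) UNIV"
    by (rule has_sum_finite_neutralI[of "{i}"]) auto
  then show ?thesis
    by (simp add: cinner_ell2.rep_eq ell2_unit.rep_eq infsumI)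
qed

lemma synthesis_diff:
  assumes "bessel_on y UNIV C"
  shows "synthesis y (c - d) = synthesis y c - synthesis y d"
  by (rule cinner_ext) (simp add: cinner_synthesis[OF assms] cinner_diff_left)

lemma synthesis_ell2_unit:
  assumes "bessel_on y UNIV C"
  shows "synthesis y (ell2_unit i) = y i"
proof (rule cinner_ext)
  fix z
  have "cinner (synthesis y (ell2_unit i)) z = cnj (cinner (analysis y z) (ell2_unit i))"
    by (simp add: cinner_synthesis[OF assms] flip: cinner_commute)
  then show "cinner (synthesis y (ell2_unit i)) z = cinner (y i) z"
    by (simp add: cinner_ell2_unit ell2_coeff_analysis[OF assms] flip: cinner_commute)
qed

text \<open>
  With \<open>k i\<close> the component of the \<open>i\<close>-th unit vector in the kernel of the synthesis operator
  and \<open>J\<close> a unitary map of that kernel onto the complement of \<open>V\<close>, the basis is \<open>y i + J (k i)\<close>.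
\<close>

lemma ex_orthonormal_basis_projecting_to:
  fixes y :: "'i::countable \<Rightarrow> 'h::chilbert_space" and g :: "'j::countable \<Rightarrow> 'h"
  assumes y: "is_parseval_frame y V" and V: "complex_vector.subspace V" "closed V"
    and total: "\<And>x. (\<And>i. cinner x (g i) = 0) \<Longrightarrow> x = 0"
    and dim: "hilbert_dim {c. synthesis y c = 0} = hilbert_dim (orthogonal_complement V)"
  obtains v where "orthonormal_basis v" "\<And>i z. z \<in> V \<Longrightarrow> cinner (v i) z = cinner (y i) z"
proof -
  note By = bessel_on_parseval[OF y V(1)]
  have yV: "y i \<in> V" for i using y by (auto simp: is_parseval_frame_def)
  define K where "K = {c. synthesis y c = 0}"
  define L where "L = orthogonal_complement V"
  have K: "complex_vector.subspace K" "closed K"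
    by (simp_all add: K_def synthesis_kernel[OF By] subspace_orthogonal_complement
        closed_orthogonal_complement)
  have L: "complex_vector.subspace L" "closed L"
    by (simp_all add: L_def subspace_orthogonal_complement closed_orthogonal_complement)
  have total_unit: "c = 0" if "\<And>i. cinner c (ell2_unit i) = 0" for c :: "'i ell2"
    using that by (intro ell2_coeff_inject[THEN iffD1]) (auto simp: cinner_ell2_unit zero_ell2.rep_eq)
  obtain J where J: "J ` K = L" "\<And>a b. a \<in> K \<Longrightarrow> b \<in> K \<Longrightarrow> cinner (J a) (J b) = cinner a b"
    using ex_isometry_of_hilbert_dim_eq[OF K L total_unit total dim[folded K_def L_def]] by metis
  \<comment> \<open>Analysis is isometric on \<open>V\<close>, and \<open>analysis y (y i)\<close>
    is the projection of the unit vector to its range; the difference lies in the kernel since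
    synthesis sends both to \<open>y i\<close>.\<close>
  define k where "k i = ell2_unit i - analysis y (y i)" for i
  define v where "v i = y i + J (k i)" for i
  have kK: "k i \<in> K" for i
    by (simp add: K_def k_def synthesis_diff[OF By] synthesis_ell2_unit[OF By]
        synthesis_analysis_parseval[OF y V(1) yV])
  have K_analysis: "cinner c (analysis y x) = 0" if "c \<in> K" for c x
    using that by (simp add: K_def flip: cinner_synthesis[OF By])
  have K_k: "cinner c (k i) = ell2_coeff c i" if "c \<in> K" for c i
    using K_analysis[OF that] by (simp add: k_def cinner_diff_right cinner_ell2_unit)
  have LV: "cinner l z = 0" "cinner z l = 0" if "l \<in> L" "z \<in> V" for l z
    using that cinner_eq_0_commute by (auto simp: L_def orthogonal_complement_def)
  have JL: "J a \<in> L" if "a \<in> K" for a using J(1) that by blast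
  have "cinner (v i) (v j) = (if i = j then 1 else 0)" for i j
  proof -
    have "cinner (v i) (v j) = cinner (y i) (y j) + cinner (k i) (k j)"
      by (simp add: v_def cinner_add_left cinner_add_right LV JL kK yV J(2))
    \<comment> \<open>The Gram matrices of \<open>k\<close> and \<open>y\<close> add up to the
      identity, which is why the orthogonal sum \<open>v\<close> is orthonormal.\<close>
    also have "cinner (k i) (k j) = (if i = j then 1 else 0) - cinner (y i) (y j)"
      unfolding K_k[OF kK] by (simp add: k_def minus_ell2.rep_eq ell2_unit.rep_eq ell2_coeff_analysis[OF By])
    finally show ?thesis by simp
  qed
  moreover have "x = 0" if x: "\<And>i. cinner x (v i) = 0" for x
  proof -
    \<comment> \<open>\<open>p\<close> is the projection of \<open>x\<close> to \<open>V\<close>, so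
      that \<open>x - p\<close> lies in the complement and has a preimage under
      \<open>J\<close>.\<close>
    define p where "p = synthesis y (analysis y x)"
    have p: "p \<in> V"
      unfolding p_def by (rule synthesis_mem[OF V]) (use yV in auto)
    have proj: "cinner p z = cinner x z" if "z \<in> V" for z
      unfolding p_def cinner_synthesis[OF By]
      using synthesis_analysis_parseval[OF y V(1) that] cinner_synthesis[OF By]
      by (metis cinner_commute)
    have "x - p \<in> L"
      using proj by (simp add: L_def orthogonal_complement_def cinner_diff_left)
    then obtain a where a: "a \<in> K" "x = p + J a"
      using J(1) by (metis (no_types, lifting) add.commute diff_add_cancel imageE)
    \<comment> \<open>The coordinates of this sequence are the vanishing
      \<open>cinner x (v i)\<close>. Its summands are orthogonal, one in the range of analysis and
      the other in the kernel of synthesis, so each is zero.\<close>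
    have "analysis y p + a = 0"
    proof (rule ell2_coeff_inject[THEN iffD1], rule ext)
      fix i
      have "cinner x (v i) = cinner p (y i) + cinner a (k i)"
        by (simp add: a(2) v_def cinner_add_left cinner_add_right LV JL kK yV J(2) a(1) p)
      then show "ell2_coeff (analysis y p + a) i = ell2_coeff 0 i"
        using x by (simp add: K_k[OF a(1)] plus_ell2.rep_eq zero_ell2.rep_eq
            ell2_coeff_analysis[OF By])
    qed
    moreover have "cinner a (analysis y p + a) = cinner a a"
      by (simp add: cinner_add_right K_analysis[OF a(1)])
    ultimately have "a = 0" "analysis y p = 0" by auto
    then have "norm p = 0" using norm_analysis_parseval[OF y V(1) p] by simp
    moreover have "cinner (J a) (J a) = 0" using J(2) a(1) \<open>a = 0\<close> by simp
    ultimately show "x = 0" by (simp add: a(2))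
  qed
  ultimately have "orthonormal_basis v"
    by (auto simp: orthonormal_basis_iff orthonormal_on_def)
  then show thesis
    by (rule that) (simp add: v_def cinner_add_left LV JL kK)
qed

section \<open>Weak R-duals with respect to an orthonormal basis\<close>

theorem theorem2p5:
  fixes w f u y :: "'i::countable \<Rightarrow> 'h::chilbert_space"
  assumes infinite_dim: "hilbert_dim (UNIV :: 'h set) = \<infinity>"
    and separable: "separable_space (euclidean :: 'h topology)"
    and w: "is_frame_sequence w"
    and f: "is_frame f UNIV"
    and u: "is_parseval_frame u UNIV"
    and y: "\<And>i. y i = (\<Sum>\<^sub>\<infinity>k. cinner (u k) (f i) *\<^sub>C canonical_dual w k)"
  shows "(\<exists>v. orthonormal_basis v \<and> is_weak_R_dual w f u v) \<longleftrightarrow>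
    is_parseval_frame y (closed_cspan (range w)) \<and>
    hilbert_dim {c. synthesis y c = 0} = hilbert_dim (orthogonal_complement (cspan (range w))) \<and>
    imat_mult (imat_transpose (gram_matrix (canonical_dual w) w) - imat_id) (gram_matrix u f)
      = (\<lambda>_ _. 0)"
proof -
  obtain A B where "frame_sequence w A B"
    using is_frame_sequenceE[OF w] .
  then interpret frame_sequence w A B .
  obtain C where Bf: "bessel_on f UNIV C"
    using f bessel_on_frame_bounds[of f UNIV] unfolding is_frame_def
    by (metis complex_vector.subspace_UNIV less_imp_le order_trans subset_UNIV)
  have Bu: "bessel_on u UNIV 1"
    by (rule bessel_on_parseval[OF u]) simp
  have total: "x = 0" if "\<And>i. cinner x (u i) = 0" for x
    using norm_analysis_parseval[OF u, of x] that by (simp add: norm_analysis_sq[OF Bu])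
  have "(\<lambda>k. (cmod (cinner (u k) (f i)))\<^sup>2) summable_on UNIV" for i
    using bessel_on_coeff_summable[OF Bu] by (simp add: cmod_cinner_commute[of "u _"])
  note gram = gram_condition_iff[OF bessel_canonical_dual this y, where w = w]
  note dual = weak_R_dual_orthonormal_iff[OF _ u Bf, where w = w]
  have W: "complex_vector.subspace W" "closed W"
    by (rule subspace_closed_cspan, rule closed_closed_cspan)
  \<comment> \<open>The dimension condition names the algebraic span, whereas the completion
    argument works with the closed subspace \<open>W\<close>.\<close>
  have compl: "orthogonal_complement (cspan (range w)) = orthogonal_complement W"
    by (simp add: orthogonal_complement_cspan orthogonal_complement_closed_cspan)
  show ?thesis
    unfolding gram compl
  proof (intro iffI; elim exE conjE)
    fix v assume v: "orthonormal_basis v" and "is_weak_R_dual w f u v"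
    then have wv: "cinner (v i) (w j) = cinner (u j) (f i)" for i j
      using dual[OF v] by (metis cinner_commute)
    have yW: "range y \<subseteq> W"
      using infsum_canonical_dual_mem y by auto
    have proj: "cinner (y i) z = cinner (v i) z" if "z \<in> W" for i z
      \<comment> \<open>Replacing the coefficients turns the series for \<open>y i\<close> into the
        canonical dual expansion of \<open>v i\<close>.\<close>
      unfolding y wv[symmetric] by (rule cinner_canonical_dual_expansion[OF that])
    show "is_parseval_frame y W \<and>
        hilbert_dim {c. synthesis y c = 0} = hilbert_dim (orthogonal_complement W) \<and>
        (\<forall>i j. cinner (y i) (w j) = cinner (u j) (f i))"
      using hilbert_dim_kernel_of_projected_basis[OF v W yW proj] proj[OF mem_W] wv by simp
  next
    assume "is_parseval_frame y W"
      and "hilbert_dim {c. synthesis y c = 0} = hilbert_dim (orthogonal_complement W)"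
      and yw: "\<forall>i j. cinner (y i) (w j) = cinner (u j) (f i)"
    then obtain v where v: "orthonormal_basis v"
      and proj: "\<And>i z. z \<in> W \<Longrightarrow> cinner (v i) z = cinner (y i) z"
      using ex_orthonormal_basis_projecting_to[OF _ W total] by metis
    have "cinner (w j) (v i) = cinner (f i) (u j)" for i j
      using proj[OF mem_W] yw by (metis cinner_commute)
    then show "\<exists>v. orthonormal_basis v \<and> is_weak_R_dual w f u v"
      using v dual by blast
  qed
qed

end
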